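(* Assume that $r_{12}=r_{32}=0$. Let $r_{21},r_{23}$ be non-negative integers with $0<r_{23}<c_3$ such that $c_2n_2=r_{21}n_1+r_{23}n_3$. Assume that $c_2>r_{21}+r_{23}$. Let $g=y^{\epsilon c_2}$ and $h=y^{b/d}-x^{(b-a)/d}z^{a/d}$. Then $$I^*=(g,h)+(p_{\alpha,\beta}\mid(\alpha,\beta)\in A)+(q_{\gamma,\sigma}\mid(\gamma,\sigma)\in B).$$ Furthermore, \begin{enumerate} \item If $\beta_h>\epsilon$, then $I^*=(g)+(p_{\alpha,\beta}\mid(\alpha,\beta)\in A)+(q_{\gamma,\sigma}\mid(\gamma,\sigma)\in B)$. \item If $\beta_h\le\epsilon$, then $I^*=(h)+(p_{\alpha,\beta}\mid(\alpha,\beta)\in A,\ \beta<\beta_h)+(q_{\gamma,\sigma}\mid(\gamma,\sigma)\in B)$. \item The minimal generators of $I^*$ form a Gr\"obner basis of $I^*$ with respect to the reverse lexicographic order. \item $\mu(I^* )\le c_3+2$. \end{enumerate}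
   Context: Let $K$ be a field and let $n_1<n_2<n_3$ be positive integers with $\gcd(n_1,n_2,n_3)=1$ that minimally generate the numerical semigroup $H=\langle n_1,n_2,n_3\rangle$. Let $S=K[x,y,z]$ with the standard grading, and let $I=I_H$ be the kernel of $S\to K[t]$, $x\mapsto t^{n_1}$, $y\mapsto t^{n_2}$, $z\mapsto t^{n_3}$. For nonzero $f\in S$, $f^*$ is its homogeneous component of smallest degree, and $I^*=(f^*\mid 0\neq f\in I)$; $\mu$ denotes the minimal number of generators. The reverse lexicographic order is the graded one with $x>y>z$. $\mathbb N$ contains $0$. Let $a=n_2-n_1$, $b=n_3-n_1$, $d=\gcd(a,b)$. Let $c_1,c_2,c_3$ be the smallest positive integers such that $c_1n_1\in\langle n_2,n_3\rangle$, $c_2n_2\in\langle n_1,n_3\rangle$, $c_3n_3\in\langle n_1,n_2\rangle$, and let $r_{ij}$ be non-negative integers with $c_1n_1=r_{12}n_2+r_{13}n_3$, $c_2n_2=r_{21}n_1+r_{23}n_3$, $c_3n_3=r_{31}n_1+r_{32}n_2$. When $r_{12}=r_{32}=0$ one has $c_1n_1=c_3n_3$. Put $\delta_1=c_1-c_3$ and $\delta_2=c_2-r_{21}-r_{23}$ (both positive). Let $\alpha_h,\beta_h$ be the positive integers determined by $\alpha_hc_1+\beta_hr_{21}=(b-a)/d$, $\beta_hc_2=b/d$, $-\alpha_hc_3+\beta_hr_{23}=a/d$. For a real number $r\geq 0$ define $\varphi_r:\mathbb N\to\mathbb N$ by $\varphi_r(t)=rt+1$ if $rt\in\mathbb N$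 and $\varphi_r(t)=\lceil rt\rceil$ otherwise. One has $\frac{\delta_2}{\delta_1}<\frac{r_{23}}{c_3}$. Let $\epsilon$ be the smallest positive integer for which there is an integer $e$ with $\frac{\delta_2}{\delta_1}<\frac{e}{\epsilon}\le\frac{r_{23}}{c_3}$, and let $\eta$ be the smallest such $e$. Set $A$: let $\alpha_0=1,\beta_0=0$. For $i\ge0$, consider the system in $(\alpha,\beta)\in\mathbb N^2$: $\alpha c_3-\beta r_{23}>0$, $\ \alpha c_3-\beta r_{23}<\alpha_ic_3-\beta_ir_{23}$, $\ \beta>\beta_i$. If it has solutions, let $\beta_{i+1}$ be the smallest value of $\beta$ among its solutions and $\alpha_{i+1}=\varphi_{r_{23}/c_3}(\beta_{i+1})$; otherwise the sequence stops (it is always finite). Let $t$ be the largest index with $\beta_t<\epsilon$ and $A=\{(\alpha_i,\beta_i)\mid i=0,\ldots,t\}$. For $\alpha,\beta\in\mathbb N$ with $\alpha c_3-\beta r_{23}\ge0$, let $p_{\alpha,\beta}=y^{\beta c_2}z^{\alpha c_3-\beta r_{23}}$. Set $B$: let $\gamma_0=0,\sigma_0=1$. For $i\ge0$, consider the system in $(\gamma,\sigma)\in\mathbb N^2$: $-\gamma\delta_1+\sigma\delta_2>0$, $\ -\gamma c_3+\sigma r_{23}<-\gamma_ic_3+\sigma_ir_{23}$, $\ \gamma>\gamma_i$. If it has solutions, let $\gamma_{i+1}$ be the smallest value of $\gamma$ among its solutions and $\sigma_{i+1}=\varphi_{\delta_1/\delta_2}(\gamma_{i+1})$; otherwise the sequence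 stops (it is always finite). Let $u$ be the largest index and $B=\{(\gamma_i,\sigma_i)\mid i=0,\ldots,u\}$. For $\gamma,\sigma\in\mathbb N$ with $-\gamma\delta_1+\sigma\delta_2>0$, let $q_{\gamma,\sigma}=x^{\gamma c_1+\sigma r_{21}}z^{-\gamma c_3+\sigma r_{23}}$. *)

theory Defs
  imports
    Complex_Main
    "HOL-Library.Poly_Mapping"
    "HOL-Library.Product_Plus"
    "HOL-Computational_Algebra.Polynomial"
begin

inductive_set semigroup_gen :: "nat set \<Rightarrow> nat set" for A where
  zero: "0 \<in> semigroup_gen A"
| add: "a \<in> A \<Longrightarrow> s \<in> semigroup_gen A \<Longrightarrow> a + s \<in> semigroup_gen A"

definition minimally_generates :: "nat set \<Rightarrow> nat set \<Rightarrow> bool" where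
  "minimally_generates A H \<longleftrightarrow> semigroup_gen A = H \<and> (\<forall>A'. A' \<subset> A \<longrightarrow> semigroup_gen A' \<noteq> H)"

definition least_multiple :: "nat \<Rightarrow> nat set \<Rightarrow> nat" where
  "least_multiple n A = (LEAST c. 0 < c \<and> c * n \<in> semigroup_gen A)"


text \<open>
  The triple \<open>(i, j, k)\<close> is the exponent vector of \<open>x\<^sup>i y\<^sup>j z\<^sup>k\<close>. With componentwise addition of
  exponents, the convolution product of \<open>Poly_Mapping\<close> is the product of polynomials.
\<close>

type_synonym expo = "nat \<times> nat \<times> nat"
type_synonym 'k poly3 = "expo \<Rightarrow>\<^sub>0 'k"

definition mon :: "nat \<Rightarrow> nat \<Rightarrow> nat \<Rightarrow> 'k::comm_ring_1 poly3" where
  "mon i j k = Poly_Mapping.single (i, j, k) 1"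

fun total_degree :: "expo \<Rightarrow> nat" where
  "total_degree (i, j, k) = i + j + k"

global_interpretation ideal: module "(*) :: 'a::comm_ring_1 \<Rightarrow> 'a \<Rightarrow> 'a"
  by unfold_locales (simp_all add: algebra_simps)

text \<open>\<^term>\<open>ideal.span G\<close> is the ideal generated by \<^term>\<open>G\<close>.\<close>

definition subst3 ::
  "'k::field poly \<Rightarrow> 'k poly \<Rightarrow> 'k poly \<Rightarrow> 'k poly3 \<Rightarrow> 'k poly" where
  "subst3 X Y Z f =
     (\<Sum>(i, j, k)\<in>Poly_Mapping.keys f. smult (Poly_Mapping.lookup f (i, j, k)) (X ^ i * Y ^ j * Z ^ k))"

definition toric_ideal :: "nat \<Rightarrow> nat \<Rightarrow> nat \<Rightarrow> 'k::field poly3 set" where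
  "toric_ideal n1 n2 n3 = {f. subst3 (monom 1 n1) (monom 1 n2) (monom 1 n3) f = 0}"

definition hom_component :: "nat \<Rightarrow> 'k::field poly3 \<Rightarrow> 'k poly3" where
  "hom_component e f =
     (\<Sum>m\<in>{m \<in> Poly_Mapping.keys f. total_degree m = e}. Poly_Mapping.single m (Poly_Mapping.lookup f m))"

definition initial_form :: "'k::field poly3 \<Rightarrow> 'k poly3" where
  "initial_form f = hom_component (Min (total_degree ` Poly_Mapping.keys f)) f"

definition initial_form_ideal :: "'k::field poly3 set \<Rightarrow> 'k poly3 set" where
  "initial_form_ideal I = ideal.span {initial_form f | f. f \<in> I \<and> f \<noteq> 0}"

definition mu :: "'k::field poly3 set \<Rightarrow> nat" where
  "mu J = (LEAST n. \<exists>G. finite G \<and> card G = n \<and> ideal.span G = J)"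

definition minimal_generating_set :: "'k::field poly3 set \<Rightarrow> 'k poly3 set \<Rightarrow> bool" where
  "minimal_generating_set G J \<longleftrightarrow>
     ideal.span G = J \<and> (\<forall>G'. G' \<subset> G \<longrightarrow> ideal.span G' \<noteq> J)"


text \<open>Graded, with \<open>x > y > z\<close>: in equal degree, the monomial with the smaller exponent at the last
  position of difference is the larger one.\<close>

fun revlex_less :: "expo \<Rightarrow> expo \<Rightarrow> bool" where
  "revlex_less (i, j, k) (i', j', k') \<longleftrightarrow>
     i + j + k < i' + j' + k' \<or>
     (i + j + k = i' + j' + k' \<and> (k' < k \<or> (k' = k \<and> j' < j)))"

definition leading_expo :: "'k::field poly3 \<Rightarrow> expo" where
  "leading_expo f =
     (THE m. m \<in> Poly_Mapping.keys f \<and> (\<forall>m'\<in>Poly_Mapping.keys f. m' \<noteq> m \<longrightarrow> revlex_less m' m))"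

definition leading_ideal :: "'k::field poly3 set \<Rightarrow> 'k poly3 set" where
  "leading_ideal F = ideal.span {Poly_Mapping.single (leading_expo f) 1 | f. f \<in> F \<and> f \<noteq> 0}"

definition groebner_basis :: "'k::field poly3 set \<Rightarrow> 'k poly3 set \<Rightarrow> bool" where
  "groebner_basis G J \<longleftrightarrow> finite G \<and> G \<subseteq> J \<and> leading_ideal G = leading_ideal J"


definition phi :: "real \<Rightarrow> nat \<Rightarrow> nat" where
  "phi r t = (if r * real t \<in> \<nat> then nat \<lfloor>r * real t\<rfloor> + 1 else nat \<lceil>r * real t\<rceil>)"

definition eps :: "nat \<Rightarrow> nat \<Rightarrow> int \<Rightarrow> int \<Rightarrow> nat" where
  "eps c3 r23 \<delta>1 \<delta>2 =
     (LEAST k. 0 < k \<and> (\<exists>e::int. real_of_int \<delta>2 / real_of_int \<delta>1 < real_of_int e / real k \<and>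
                                real_of_int e / real k \<le> real r23 / real c3))"

fun systemA :: "nat \<Rightarrow> nat \<Rightarrow> nat \<times> nat \<Rightarrow> nat \<times> nat \<Rightarrow> bool" where
  "systemA c3 r23 (\<alpha>i, \<beta>i) (\<alpha>, \<beta>) \<longleftrightarrow>
     int \<alpha> * int c3 - int \<beta> * int r23 > 0 \<and>
     int \<alpha> * int c3 - int \<beta> * int r23 < int \<alpha>i * int c3 - int \<beta>i * int r23 \<and>
     \<beta> > \<beta>i"

text \<open>The value \<^term>\<open>None\<close> means that the sequence has already stopped.\<close>

primrec seqA :: "nat \<Rightarrow> nat \<Rightarrow> nat \<Rightarrow> (nat \<times> nat) option" where
  "seqA c3 r23 0 = Some (1, 0)"
| "seqA c3 r23 (Suc i) =
     (case seqA c3 r23 i of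
        None \<Rightarrow> None
      | Some v \<Rightarrow>
          if \<exists>\<alpha> \<beta>. systemA c3 r23 v (\<alpha>, \<beta>)
          then (let \<beta> = (LEAST \<beta>. \<exists>\<alpha>. systemA c3 r23 v (\<alpha>, \<beta>))
                in Some (phi (real r23 / real c3) \<beta>, \<beta>))
          else None)"

definition setA :: "nat \<Rightarrow> nat \<Rightarrow> nat \<Rightarrow> (nat \<times> nat) set" where
  "setA c3 r23 \<epsilon> =
     (let t = (GREATEST i. \<exists>\<alpha> \<beta>. seqA c3 r23 i = Some (\<alpha>, \<beta>) \<and> \<beta> < \<epsilon>)
      in {v. \<exists>i\<le>t. seqA c3 r23 i = Some v})"

fun systemB :: "nat \<Rightarrow> nat \<Rightarrow> int \<Rightarrow> int \<Rightarrow> nat \<times> nat \<Rightarrow> nat \<times> nat \<Rightarrow> bool" where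
  "systemB c3 r23 \<delta>1 \<delta>2 (\<gamma>i, \<sigma>i) (\<gamma>, \<sigma>) \<longleftrightarrow>
     - int \<gamma> * \<delta>1 + int \<sigma> * \<delta>2 > 0 \<and>
     - int \<gamma> * int c3 + int \<sigma> * int r23 < - int \<gamma>i * int c3 + int \<sigma>i * int r23 \<and>
     \<gamma> > \<gamma>i"

primrec seqB :: "nat \<Rightarrow> nat \<Rightarrow> int \<Rightarrow> int \<Rightarrow> nat \<Rightarrow> (nat \<times> nat) option" where
  "seqB c3 r23 \<delta>1 \<delta>2 0 = Some (0, 1)"
| "seqB c3 r23 \<delta>1 \<delta>2 (Suc i) =
     (case seqB c3 r23 \<delta>1 \<delta>2 i of
        None \<Rightarrow> None
      | Some v \<Rightarrow>
          if \<exists>\<gamma> \<sigma>. systemB c3 r23 \<delta>1 \<delta>2 v (\<gamma>, \<sigma>)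
          then (let \<gamma> = (LEAST \<gamma>. \<exists>\<sigma>. systemB c3 r23 \<delta>1 \<delta>2 v (\<gamma>, \<sigma>))
                in Some (\<gamma>, phi (real_of_int \<delta>1 / real_of_int \<delta>2) \<gamma>))
          else None)"

text \<open>The indices of the second sequence are not bounded, since \<open>u\<close> is its last index.\<close>

definition setB :: "nat \<Rightarrow> nat \<Rightarrow> int \<Rightarrow> int \<Rightarrow> (nat \<times> nat) set" where
  "setB c3 r23 \<delta>1 \<delta>2 = {v. \<exists>i. seqB c3 r23 \<delta>1 \<delta>2 i = Some v}"

text \<open>
  The subtractions are on \<^typ>\<open>nat\<close>. They do not truncate where the monomials are used:
  \<open>\<alpha> c\<^sub>3 - \<beta> r\<^sub>2\<^sub>3 \<ge> 0\<close> is required for the first one, and for the second one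
  \<open>\<sigma> \<delta>\<^sub>2 > \<gamma> \<delta>\<^sub>1\<close> and \<open>\<delta>\<^sub>2 / \<delta>\<^sub>1 < r\<^sub>2\<^sub>3 / c\<^sub>3\<close> give \<open>\<sigma> r\<^sub>2\<^sub>3 > \<gamma> c\<^sub>3\<close>.
\<close>

definition p_mon :: "nat \<Rightarrow> nat \<Rightarrow> nat \<Rightarrow> nat \<Rightarrow> nat \<Rightarrow> 'k::field poly3" where
  "p_mon c2 c3 r23 \<alpha> \<beta> = mon 0 (\<beta> * c2) (\<alpha> * c3 - \<beta> * r23)"

definition q_mon :: "nat \<Rightarrow> nat \<Rightarrow> nat \<Rightarrow> nat \<Rightarrow> nat \<Rightarrow> nat \<Rightarrow> 'k::field poly3" where
  "q_mon c1 c3 r21 r23 \<gamma> \<sigma> = mon (\<gamma> * c1 + \<sigma> * r21) 0 (\<sigma> * r23 - \<gamma> * c3)"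

end

theory Submission
  imports Defs
begin

text \<open>
  Give \<open>x\<close>, \<open>y\<close>, \<open>z\<close> the weights \<open>n1\<close>, \<open>n2\<close>, \<open>n3\<close>. The toric ideal is spanned by the differences
  of monomials of equal weight. Call a monomial nonmaximal if another monomial of the same weight
  has larger total degree. Taking initial forms weight by weight shows that \<open>I*\<close> is spanned by the
  nonmaximal monomials and by the differences of monomials of equal weight and equal degree
  (\<open>initial_form_ideal_toric\<close>). Two exponent vectors of equal weight and degree differ by a
  multiple of the exponent vector of \<open>h\<close>, so those differences lie in \<open>(h)\<close>
  (\<open>similar_diff_in_span\<close>). What remains is to find finitely many nonmaximal monomials that
  generate all others.

  The minimality of \<open>c1\<close>, \<open>c2\<close>, \<open>c3\<close> and \<open>r12 = r32 = 0\<close> imply that the lattice of relations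
  between \<open>n1\<close>, \<open>n2\<close>, \<open>n3\<close> is generated by \<open>(c1, 0, -c3)\<close> and \<open>(r21, -c2, r23)\<close>
  (\<open>relation_lattice\<close>). A monomial is nonmaximal iff adding some combination
  \<open>s (c1, 0, -c3) + t (r21, -c2, r23)\<close> with \<open>s \<delta>1 > t \<delta>2\<close> keeps its exponents nonnegative. Sorting
  by the signs of \<open>s\<close>, \<open>t\<close> and of \<open>s c3 - t r23\<close>, it is then divisible by \<open>g\<close>, by some \<open>p\<close> with
  \<open>\<alpha> c3 > \<beta> r23\<close>, or by some \<open>q\<close> with \<open>\<sigma> \<delta>2 > \<gamma> \<delta>1\<close>. Among the \<open>p\<close> only those matter in which the
  exponent of \<open>z\<close> is smaller than for every smaller \<open>\<beta>\<close>, and similarly for the \<open>q\<close>; the recursions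
  for \<open>A\<close> and \<open>B\<close> enumerate exactly these strict records (\<open>setA_eq_records\<close>, \<open>setB_eq_records\<close>).
  Conversely \<open>g\<close>, \<open>p\<close> and \<open>q\<close> are nonmaximal. This gives the generators of \<open>I*\<close>.

  Nonmaximality depends on weight and degree only. This settles the two refinements. If \<open>\<beta>h > \<epsilon>\<close>,
  the first term of \<open>h\<close> is a multiple of \<open>g\<close>, so both its terms are nonmaximal and \<open>h\<close> is
  redundant. If \<open>\<beta>h \<le> \<epsilon>\<close>, a nonmaximal monomial divisible by \<open>y\<close> to the power \<open>b / d = \<beta>h c2\<close> is
  congruent modulo \<open>h\<close> to a nonmaximal monomial with a smaller exponent of \<open>y\<close>, so by induction
  \<open>g\<close> and the \<open>p\<close> with \<open>\<beta> \<ge> \<beta>h\<close> are redundant.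

  For the Groebner property, the sum of the coefficients over a class of maximal monomials of
  equal weight and degree vanishes on \<open>I*\<close>. Hence a leading monomial of an element of \<open>I*\<close> is
  nonmaximal, or it shares its class with a smaller monomial and is divisible by the leading
  monomial of \<open>h\<close>. An arbitrary generating subset inherits the leading monomials, because the
  trailing monomial of \<open>h\<close> divides none of the generators. Finally, the exponents of \<open>z\<close> in the
  \<open>q\<close> are distinct numbers in \<open>{1..r23}\<close>, and those in the \<open>p\<close> with \<open>\<beta> > 0\<close> are distinct numbers
  in \<open>{1..c3 - r23}\<close>, so together with \<open>z\<^sup>c\<^sup>3\<close> there are at most \<open>c3 + 1\<close> of them, and either \<open>g\<close>
  or \<open>h\<close> is the only further generator that is needed.
\<close>

section \<open>Monomials in ideals and leading exponents\<close>

lemma poly3_as_sum_of_terms: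
  fixes f :: "'k::field poly3"
  shows "(\<Sum>m\<in>Poly_Mapping.keys f. Poly_Mapping.single m (Poly_Mapping.lookup f m)) = f"
  by (rule poly_mapping_eqI)
     (auto simp: lookup_sum lookup_single when_def in_keys_iff if_distrib sum.delta' cong: if_cong)

lemma single_add_mem_span:
  fixes c :: "'k::field"
  assumes "Poly_Mapping.single v 1 \<in> ideal.span F"
  shows "Poly_Mapping.single (t + v) c \<in> ideal.span F"
  using ideal.span_scale[OF assms, of "Poly_Mapping.single t c"] by (simp add: mult_single)

lemma keys_of_span:
  fixes f :: "'k::field poly3"
  assumes "f \<in> ideal.span F" and "m \<in> Poly_Mapping.keys f"
  shows "\<exists>u\<in>F. \<exists>v\<in>Poly_Mapping.keys u. \<exists>t. m = t + v"
  using assms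
proof (induction arbitrary: m rule: ideal.span_induct_alt)
  case base
  then show ?case by simp
next
  case (step r u g)
  then have "m \<in> Poly_Mapping.keys (r * u) \<or> m \<in> Poly_Mapping.keys g"
    using keys_add[of "r * u" g] by auto
  then show ?case
  proof
    assume "m \<in> Poly_Mapping.keys (r * u)"
    then obtain t v where "m = t + v" "v \<in> Poly_Mapping.keys u"
      using keys_mult[of r u] by fast
    with step.hyps show ?thesis by metis
  qed (rule step.IH)
qed

text \<open>
  The linear functional with the values \<open>\<phi>\<close> on monomials. It expresses both the substitution that
  defines the toric ideal and the coefficient sums that vanish on the initial form ideal.
\<close>

definition pairing :: "(expo \<Rightarrow> 'k::field) \<Rightarrow> 'k poly3 \<Rightarrow> 'k" where
  "pairing \<phi> f = (\<Sum>m\<in>Poly_Mapping.keys f. Poly_Mapping.lookup f m * \<phi> m)"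

lemma pairing_superset:
  assumes "finite S" and "Poly_Mapping.keys f \<subseteq> S"
  shows "pairing \<phi> f = (\<Sum>m\<in>S. Poly_Mapping.lookup f m * \<phi> m)"
  unfolding pairing_def using assms
  by (intro sum.mono_neutral_left) (auto simp: in_keys_iff)

lemma pairing_add: "pairing \<phi> (f + g) = pairing \<phi> f + pairing \<phi> g"
proof -
  let ?S = "Poly_Mapping.keys f \<union> Poly_Mapping.keys g"
  have "Poly_Mapping.keys (f + g) \<subseteq> ?S" by (rule keys_add)
  then have "pairing \<phi> (f + g) = (\<Sum>m\<in>?S. Poly_Mapping.lookup (f + g) m * \<phi> m)"
    by (intro pairing_superset) auto
  also have "\<dots> = pairing \<phi> f + pairing \<phi> g"
    by (simp add: pairing_superset[of ?S] lookup_add distrib_right sum.distrib)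
  finally show ?thesis .
qed

lemma pairing_zero [simp]: "pairing \<phi> 0 = 0"
  by (simp add: pairing_def)

lemma pairing_single [simp]: "pairing \<phi> (Poly_Mapping.single m c) = c * \<phi> m"
  by (subst pairing_superset[of "{m}"]) auto

lemma pairing_diff: "pairing \<phi> (f - g) = pairing \<phi> f - pairing \<phi> g"
  using pairing_add[of \<phi> "f - g" g] by simp

lemma pairing_sum: "pairing \<phi> (sum f S) = (\<Sum>x\<in>S. pairing \<phi> (f x))"
  by (induction S rule: infinite_finite_induct) (auto simp: pairing_add)

lemma expo_split:
  fixes i j k :: nat
  assumes "i' \<le> i" and "j' \<le> j" and "k' \<le> k"
  shows "\<exists>t. (i, j, k) = t + (i', j', k')"
  using assms by (intro exI[of _ "(i - i', j - j', k - k')"]) simp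

lemma total_degree_add [simp]: "total_degree (m + m') = total_degree m + total_degree m'"
  by (cases m; cases m') simp

lemma lookup_hom_component:
  "Poly_Mapping.lookup (hom_component e f) m =
     (if total_degree m = e then Poly_Mapping.lookup f m else 0)"
proof -
  have "Poly_Mapping.lookup (hom_component e f) m =
     (\<Sum>m'\<in>{m' \<in> Poly_Mapping.keys f. total_degree m' = e}.
        if m' = m then Poly_Mapping.lookup f m' else 0)"
    by (simp add: hom_component_def lookup_sum lookup_single when_def)
  also have "\<dots> = (if total_degree m = e then Poly_Mapping.lookup f m else 0)"
    by (auto simp: sum.delta in_keys_iff)
  finally show ?thesis .
qed

lemma revlex_less_total: "m \<noteq> m' \<Longrightarrow> revlex_less m m' \<or> revlex_less m' m"
  by (cases m; cases m') auto

lemma revlex_less_trans: "revlex_less m m' \<Longrightarrow> revlex_less m' m'' \<Longrightarrow> revlex_less m m''"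
  by (cases m; cases m'; cases m'') auto

lemma revlex_less_asym: "revlex_less m m' \<Longrightarrow> \<not> revlex_less m' m"
  by (cases m; cases m') auto

lemma leading_expo_eqI:
  assumes "m \<in> Poly_Mapping.keys f"
    and "\<And>m'. m' \<in> Poly_Mapping.keys f \<Longrightarrow> m' \<noteq> m \<Longrightarrow> revlex_less m' m"
  shows "leading_expo f = m"
  unfolding leading_expo_def
proof (rule the_equality)
  show "m \<in> Poly_Mapping.keys f \<and> (\<forall>m'\<in>Poly_Mapping.keys f. m' \<noteq> m \<longrightarrow> revlex_less m' m)"
    using assms by simp
next
  fix u
  assume "u \<in> Poly_Mapping.keys f \<and> (\<forall>m'\<in>Poly_Mapping.keys f. m' \<noteq> u \<longrightarrow> revlex_less m' u)"
  then show "u = m" using assms revlex_less_asym[of u m] by metis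
qed

lemma leading_expo_maximal:
  fixes f :: "'k::field poly3"
  assumes "f \<noteq> 0"
  shows "leading_expo f \<in> Poly_Mapping.keys f"
    and "\<And>m. m \<in> Poly_Mapping.keys f \<Longrightarrow> m \<noteq> leading_expo f \<Longrightarrow> revlex_less m (leading_expo f)"
proof -
  have "\<exists>m\<in>S. \<forall>m'\<in>S. m' \<noteq> m \<longrightarrow> revlex_less m' m" if "finite S" "S \<noteq> {}" for S
    using that
  proof (induction S rule: finite_ne_induct)
    case (singleton x)
    then show ?case by simp
  next
    case (insert x S)
    then obtain m where m: "m \<in> S" "\<forall>m'\<in>S. m' \<noteq> m \<longrightarrow> revlex_less m' m" by blast
    show ?case
    proof (cases "revlex_less m x")
      case True
      have "revlex_less m' x" if "m' \<in> S" for m'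
        using m(2) that True revlex_less_trans[of m' m x] by metis
      then show ?thesis by auto
    next
      case False
      then have "revlex_less x m" using revlex_less_total[of x m] insert.hyps(3) m(1) by metis
      then show ?thesis using m by auto
    qed
  qed
  from this[of "Poly_Mapping.keys f"] obtain m where m: "m \<in> Poly_Mapping.keys f"
    "\<forall>m'\<in>Poly_Mapping.keys f. m' \<noteq> m \<longrightarrow> revlex_less m' m"
    using assms by auto
  then have eq: "leading_expo f = m" by (intro leading_expo_eqI) auto
  show "leading_expo f \<in> Poly_Mapping.keys f" unfolding eq by (rule m(1))
  show "revlex_less u (leading_expo f)" if "u \<in> Poly_Mapping.keys f" "u \<noteq> leading_expo f" for u
    using m(2) that unfolding eq by simp
qed

lemma leading_expo_single [simp]: "c \<noteq> 0 \<Longrightarrow> leading_expo (Poly_Mapping.single m c) = m"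
  by (rule leading_expo_eqI) auto

section \<open>Initial forms of a toric ideal\<close>

locale weights =
  fixes n1 n2 n3 :: nat
begin

fun wt :: "expo \<Rightarrow> nat" where
  "wt (i, j, k) = i * n1 + j * n2 + k * n3"

text \<open>
  These are the exponent vectors of the initial forms of the binomials in the toric ideal whose
  two terms have different degrees.
\<close>

definition nonmax :: "expo \<Rightarrow> bool" where
  "nonmax m \<longleftrightarrow> (\<exists>m'. wt m' = wt m \<and> total_degree m < total_degree m')"

definition similar :: "expo \<Rightarrow> expo \<Rightarrow> bool" where
  "similar m m' \<longleftrightarrow> total_degree m = total_degree m' \<and> wt m = wt m'"

lemma wt_add [simp]: "wt (m + m') = wt m + wt m'"
  by (cases m; cases m') (simp add: algebra_simps)

lemma nonmax_add: "nonmax m \<Longrightarrow> nonmax (t + m)"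
  unfolding nonmax_def by (metis nat_add_left_cancel_less total_degree_add wt_add)

lemma nonmax_similar: "similar m m' \<Longrightarrow> nonmax m \<Longrightarrow> nonmax m'"
  unfolding nonmax_def similar_def by simp

lemma similar_add_left [simp]: "similar (t + m) (t + m') \<longleftrightarrow> similar m m'"
  by (simp add: similar_def)

text \<open>
  The substitution sends all monomials of weight \<open>w\<close> to \<open>t\<^sup>w\<close>, so the coefficient of \<open>t\<^sup>w\<close> in the
  image is a coefficient sum.
\<close>

lemma toric_ideal_iff:
  fixes f :: "'k::field poly3"
  shows "f \<in> toric_ideal n1 n2 n3 \<longleftrightarrow> (\<forall>w. pairing (\<lambda>m. if wt m = w then 1 else 0) f = 0)"
proof -
  have "subst3 (monom 1 n1) (monom 1 n2) (monom 1 n3) f =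
      (\<Sum>m\<in>Poly_Mapping.keys f. monom (Poly_Mapping.lookup f m) (wt m))"
    unfolding subst3_def
    by (rule sum.cong) (auto simp: monom_power mult_monom smult_monom algebra_simps)
  then show ?thesis
    by (simp add: toric_ideal_def poly_eq_iff coeff_sum pairing_def if_distrib cong: if_cong)
qed

lemma binomial_in_toric_ideal:
  assumes "wt m = wt m'"
  shows "Poly_Mapping.single m 1 - Poly_Mapping.single m' (1 :: 'k::field) \<in> toric_ideal n1 n2 n3"
  using assms by (simp add: toric_ideal_iff pairing_diff)

definition initial_generators :: "'k::field poly3 set" where
  "initial_generators =
     {Poly_Mapping.single m 1 | m. nonmax m} \<union>
     {Poly_Mapping.single m 1 - Poly_Mapping.single m' 1 | m m'. similar m m'}"

lemma initial_generators_in_initial_form_ideal: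
  "initial_generators \<subseteq> initial_form_ideal (toric_ideal n1 n2 n3 :: 'k::field poly3 set)"
proof -
  have *: "hom_component (total_degree m) f \<in> initial_form_ideal (toric_ideal n1 n2 n3)"
    if f: "f = Poly_Mapping.single m 1 - Poly_Mapping.single m' (1 :: 'k)"
      and wt: "wt m = wt m'" and deg: "total_degree m \<le> total_degree m'" and neq: "m \<noteq> m'"
    for m m' f
  proof -
    have keys: "Poly_Mapping.keys f = {m, m'}"
      using neq by (auto simp: f in_keys_iff lookup_minus lookup_single when_def split: if_splits)
    then have "f \<noteq> 0" by auto
    moreover have "initial_form f = hom_component (total_degree m) f"
      unfolding initial_form_def keys using deg by simp
    moreover have "f \<in> toric_ideal n1 n2 n3"
      unfolding f using wt by (rule binomial_in_toric_ideal)
    ultimately show ?thesis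
      unfolding initial_form_ideal_def by (intro ideal.span_base CollectI exI[of _ f]) simp
  qed
  have "Poly_Mapping.single m 1 \<in> initial_form_ideal (toric_ideal n1 n2 n3 :: 'k poly3 set)"
    if nm: "nonmax m" for m
  proof -
    obtain m' where m': "wt m = wt m'" "total_degree m < total_degree m'"
      using nm unfolding nonmax_def by metis
    let ?f = "Poly_Mapping.single m 1 - Poly_Mapping.single m' (1 :: 'k)"
    have "hom_component (total_degree m) ?f = Poly_Mapping.single m 1"
      using m' by (intro poly_mapping_eqI)
        (auto simp: lookup_hom_component lookup_minus lookup_single when_def)
    moreover have "m \<noteq> m'" using m'(2) by auto
    ultimately show ?thesis using *[OF refl m'(1)] m'(2) by simp
  qed
  moreover have "Poly_Mapping.single m 1 - Poly_Mapping.single m' 1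
      \<in> initial_form_ideal (toric_ideal n1 n2 n3 :: 'k poly3 set)"
    if sim: "similar m m'" for m m'
  proof (cases "m = m'")
    case True
    then show ?thesis by (simp add: initial_form_ideal_def ideal.span_zero)
  next
    case False
    let ?f = "Poly_Mapping.single m 1 - Poly_Mapping.single m' (1 :: 'k)"
    have "hom_component (total_degree m) ?f = ?f"
      using sim by (intro poly_mapping_eqI)
        (auto simp: similar_def lookup_hom_component lookup_minus lookup_single when_def)
    then show ?thesis using *[OF refl _ _ False] sim by (simp add: similar_def)
  qed
  ultimately show ?thesis unfolding initial_generators_def by blast
qed

text \<open>
  A combination with coefficient sum \<open>0\<close> of pairwise similar monomials is a combination of
  differences with one fixed monomial among them.
\<close>

lemma similar_terms_in_span:
  fixes c :: "expo \<Rightarrow> 'k::field"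
  assumes "finite S" and "\<And>m m'. m \<in> S \<Longrightarrow> m' \<in> S \<Longrightarrow> similar m m'" and "sum c S = 0"
  shows "(\<Sum>m\<in>S. Poly_Mapping.single m (c m)) \<in> ideal.span initial_generators"
proof (cases "S = {}")
  case False
  then obtain m0 where "m0 \<in> S" by blast
  have "Poly_Mapping.single m (c m) - Poly_Mapping.single m0 (c m) \<in> ideal.span initial_generators"
    if "m \<in> S" for m
  proof -
    have "Poly_Mapping.single m 1 - Poly_Mapping.single m0 1 \<in> initial_generators"
      using assms(2)[OF that \<open>m0 \<in> S\<close>] unfolding initial_generators_def by blast
    from ideal.span_scale[OF ideal.span_base[OF this], of "Poly_Mapping.single 0 (c m)"]
    show ?thesis by (simp add: right_diff_distrib mult_single)
  qed
  then have "(\<Sum>m\<in>S. Poly_Mapping.single m (c m) - Poly_Mapping.single m0 (c m))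
      \<in> ideal.span initial_generators"
    by (rule ideal.span_sum)
  moreover have "(\<Sum>m\<in>S. Poly_Mapping.single m0 (c m)) = Poly_Mapping.single m0 (sum c S)"
    by (induction S rule: infinite_finite_induct) (auto simp: single_add)
  ultimately show ?thesis using assms(3) by (simp add: sum_subtractf)
qed (simp add: ideal.span_zero)

text \<open>
  An initial form splits into its weight components. If \<open>f\<close> has terms of higher degree in some
  weight, every lowest term of that weight is nonmaximal. Otherwise all terms of that weight have
  the lowest degree, and their coefficients sum to \<open>0\<close> because \<open>f\<close> is in the toric ideal.
\<close>

theorem initial_form_ideal_toric:
  "initial_form_ideal (toric_ideal n1 n2 n3 :: 'k::field poly3 set) = ideal.span initial_generators"
proof
  show "ideal.span initial_generators \<subseteq> initial_form_ideal (toric_ideal n1 n2 n3 :: 'k poly3 set)"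
    using initial_generators_in_initial_form_ideal
    by (intro ideal.span_minimal) (simp_all add: initial_form_ideal_def)
  have "initial_form f \<in> ideal.span initial_generators"
    if f: "f \<in> toric_ideal n1 n2 n3" "f \<noteq> 0" for f :: "'k poly3"
  proof -
    define e where "e = Min (total_degree ` Poly_Mapping.keys f)"
    define K where "K = {m \<in> Poly_Mapping.keys f. total_degree m = e}"
    have fin: "finite K" by (simp add: K_def)
    have e_le: "e \<le> total_degree m" if "m \<in> Poly_Mapping.keys f" for m
      using that by (simp add: e_def)
    have "(\<Sum>m\<in>{m\<in>K. wt m = w}. Poly_Mapping.single m (Poly_Mapping.lookup f m))
        \<in> ideal.span initial_generators" for w
    proof (cases "\<exists>m'\<in>Poly_Mapping.keys f. wt m' = w \<and> total_degree m' \<noteq> e")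
      case True
      then have "nonmax m" if "m \<in> K" "wt m = w" for m
        using True that e_le unfolding nonmax_def K_def by (metis (lifting) le_neq_implies_less mem_Collect_eq)
      then have gen: "Poly_Mapping.single m 1 \<in> (initial_generators :: 'k poly3 set)"
        if "m \<in> K" "wt m = w" for m
        using that unfolding initial_generators_def by blast
      have "Poly_Mapping.single m (Poly_Mapping.lookup f m) \<in> ideal.span initial_generators"
        if "m \<in> K" "wt m = w" for m
        using single_add_mem_span[OF ideal.span_base[OF gen[OF that]], of 0] by simp
      then show ?thesis by (intro ideal.span_sum) auto
    next
      case False
      then have "{m\<in>K. wt m = w} = {m\<in>Poly_Mapping.keys f. wt m = w}"
        unfolding K_def by blast
      then have "sum (Poly_Mapping.lookup f) {m\<in>K. wt m = w}
          = (\<Sum>m\<in>Poly_Mapping.keys f. if wt m = w then Poly_Mapping.lookup f m else 0)"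
        by (simp only: sum.inter_filter[OF finite_keys])
      also have "\<dots> = 0"
        using f(1) by (simp add: toric_ideal_iff pairing_def if_distrib cong: if_cong)
      finally show ?thesis
        using fin by (intro similar_terms_in_span) (auto simp: similar_def K_def)
    qed
    then have "(\<Sum>w\<in>wt ` K. \<Sum>m\<in>{m\<in>K. wt m = w}. Poly_Mapping.single m (Poly_Mapping.lookup f m))
        \<in> ideal.span initial_generators"
      by (rule ideal.span_sum)
    moreover have "(\<Sum>w\<in>wt ` K. \<Sum>m\<in>{m\<in>K. wt m = w}. Poly_Mapping.single m (Poly_Mapping.lookup f m))
        = initial_form f"
      unfolding initial_form_def hom_component_def e_def[symmetric] K_def[symmetric]
      by (rule sum.group[OF fin finite_imageI[OF fin, of wt] order_refl])
    ultimately show ?thesis by (simp only:)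
  qed
  then show "initial_form_ideal (toric_ideal n1 n2 n3 :: 'k poly3 set) \<subseteq> ideal.span initial_generators"
    unfolding initial_form_ideal_def by (intro ideal.span_minimal) auto
qed

text \<open>
  Multiplying a generator of the initial form ideal by a monomial gives a nonmaximal monomial,
  which is not in the class of \<open>m\<close>, or a difference of similar monomials, whose two terms lie both
  inside or both outside that class.
\<close>

lemma initial_form_ideal_class_sum:
  fixes f :: "'k::field poly3"
  assumes "f \<in> initial_form_ideal (toric_ideal n1 n2 n3)" and "\<not> nonmax m"
  shows "pairing (\<lambda>m'. if similar m m' then 1 else 0) f = 0"
  using assms(1) unfolding initial_form_ideal_toric
proof (induction rule: ideal.span_induct_alt)
  case base
  then show ?case by simp
next
  case (step r u g)
  let ?\<phi> = "\<lambda>m'. if similar m m' then 1 else (0 :: 'k)"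
  have "pairing ?\<phi> (Poly_Mapping.single t c * u) = 0" for t and c :: 'k
    using step.hyps unfolding initial_generators_def
  proof (elim UnE CollectE exE conjE)
    fix v assume "u = Poly_Mapping.single v 1" "nonmax v"
    moreover from this have "\<not> similar m (t + v)"
      using assms(2) nonmax_add[of v t] nonmax_similar[of "t + v" m] unfolding similar_def by metis
    ultimately show ?thesis by (simp add: mult_single)
  next
    fix v v' assume u: "u = Poly_Mapping.single v 1 - Poly_Mapping.single v' 1" and "similar v v'"
    then have "similar m (t + v) \<longleftrightarrow> similar m (t + v')" by (simp add: similar_def)
    then show ?thesis by (simp add: u right_diff_distrib mult_single pairing_diff)
  qed
  then have "pairing ?\<phi>
      ((\<Sum>t\<in>Poly_Mapping.keys r. Poly_Mapping.single t (Poly_Mapping.lookup r t)) * u) = 0"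
    by (simp add: sum_distrib_right pairing_sum)
  then show ?case using step.IH by (simp add: poly3_as_sum_of_terms pairing_add)
qed

lemma max_term_has_similar_term:
  fixes f :: "'k::field poly3"
  assumes f: "f \<in> initial_form_ideal (toric_ideal n1 n2 n3)"
    and m: "m \<in> Poly_Mapping.keys f" "\<not> nonmax m"
  shows "\<exists>m'\<in>Poly_Mapping.keys f. m' \<noteq> m \<and> similar m m'"
proof (rule ccontr)
  assume "\<not> ?thesis"
  then have "pairing (\<lambda>m'. if similar m m' then 1 else 0) f
      = (\<Sum>m'\<in>Poly_Mapping.keys f. if m' = m then Poly_Mapping.lookup f m' else 0)"
    unfolding pairing_def by (intro sum.cong) (auto simp: similar_def)
  also have "\<dots> = Poly_Mapping.lookup f m" using m by (simp add: sum.delta)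
  finally show False
    using initial_form_ideal_class_sum[OF f m(2)] m(1) by (simp add: in_keys_iff)
qed

end

section \<open>Strict records of a sequence\<close>

definition records :: "(nat \<Rightarrow> 'a::linorder) \<Rightarrow> nat set" where
  "records f = {t. \<forall>s<t. f t < f s}"

lemma record_below: "\<exists>s\<in>records f. s \<le> t \<and> f s \<le> f t"
proof (induction t rule: less_induct)
  case (less t)
  show ?case
  proof (cases "t \<in> records f")
    case False
    then obtain s where s: "s < t" "f s \<le> f t" by (auto simp: records_def not_less)
    then obtain u where u: "u \<in> records f" "u \<le> s" "f u \<le> f s" using less.IH by blast
    show ?thesis
      using u(1) order_trans[OF u(2) less_imp_le[OF s(1)]] order_trans[OF u(3) s(2)] by blast
  qed blast
qed

primrec record_seq :: "(nat \<Rightarrow> 'a::linorder) \<Rightarrow> nat \<Rightarrow> nat option" where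
  "record_seq f 0 = Some 0"
| "record_seq f (Suc i) =
     (case record_seq f i of
        None \<Rightarrow> None
      | Some t \<Rightarrow>
          if \<exists>t'. t < t' \<and> f t' < f t then Some (LEAST t'. t < t' \<and> f t' < f t) else None)"

lemma record_seq_SucD:
  assumes "record_seq f (Suc i) = Some t"
  shows "\<exists>s. record_seq f i = Some s \<and> s < t \<and> f t < f s \<and> (\<forall>u. s < u \<longrightarrow> u < t \<longrightarrow> f s \<le> f u)"
proof -
  obtain s where s: "record_seq f i = Some s"
    and ex: "\<exists>t'. s < t' \<and> f t' < f s" and t: "t = (LEAST t'. s < t' \<and> f t' < f s)"
    using assms by (auto split: option.splits if_splits)
  have "s < t \<and> f t < f s" unfolding t using ex by (rule LeastI_ex)
  moreover have "f s \<le> f u" if "s < u" "u < t" for u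
    using that not_less_Least[of u "\<lambda>t'. s < t' \<and> f t' < f s"] unfolding t by auto
  ultimately show ?thesis using s by auto
qed

lemma record_seq_in_records: "record_seq f i = Some t \<Longrightarrow> t \<in> records f"
proof (induction i arbitrary: t)
  case 0
  then show ?case by (simp add: records_def)
next
  case (Suc i)
  from Suc.prems obtain s where s: "record_seq f i = Some s" "s < t" "f t < f s"
    "\<forall>u. s < u \<longrightarrow> u < t \<longrightarrow> f s \<le> f u"
    using record_seq_SucD by blast
  have "f t < f u" if "u < t" for u
  proof (cases u s rule: linorder_cases)
    case less
    then have "f s < f u" using Suc.IH[OF s(1)] by (simp add: records_def)
    with s(3) show ?thesis by (rule less_trans)
  next
    case greater
    then have "f s \<le> f u" using s(4) that by simp
    with s(3) show ?thesis by (rule less_le_trans)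
  qed (use s(3) in simp)
  then show ?case by (simp add: records_def)
qed

text \<open>
  Between two consecutive records there is no value below the earlier one. So the step from the
  largest record below \<open>t\<close> leads to \<open>t\<close>.
\<close>

lemma records_in_record_seq: "t \<in> records f \<Longrightarrow> \<exists>i. record_seq f i = Some t"
proof (induction t rule: less_induct)
  case (less t)
  show ?case
  proof (cases "t = 0")
    case True
    then show ?thesis by (intro exI[of _ 0]) simp
  next
    case False
    define S where "S = {s \<in> records f. s < t}"
    have "finite S" "S \<noteq> {}" using False by (auto simp: S_def records_def intro!: exI[of _ 0])
    then have max: "Max S \<in> S" "\<And>s. s \<in> S \<Longrightarrow> s \<le> Max S" by auto
    define s where "s = Max S"
    have s: "s < t" "s \<in> records f" using max(1) by (auto simp: S_def s_def)
    then obtain i where i: "record_seq f i = Some s" using less.IH by blast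
    have "f t < f s" using less.prems s by (simp add: records_def)
    with s(1) have next_t: "s < t \<and> f t < f s" by simp
    define u where "u = (LEAST t'. s < t' \<and> f t' < f s)"
    have u: "record_seq f (Suc i) = Some u" using i next_t by (auto simp: u_def)
    have "u \<le> t" unfolding u_def using next_t by (rule Least_le)
    moreover have "s < u" unfolding u_def using LeastI[of "\<lambda>t'. s < t' \<and> f t' < f s", OF next_t] by simp
    moreover have "u \<in> records f" using u by (rule record_seq_in_records)
    ultimately have "u = t"
      using max(2)[of u] by (fastforce simp: S_def s_def)
    then show ?thesis using u by blast
  qed
qed

lemma records_eq_range_record_seq: "records f = {t. \<exists>i. record_seq f i = Some t}"
  using record_seq_in_records records_in_record_seq by blast

text \<open>
  The members of the sequence increase, by at least \<open>1\<close> in each step. This bounds the index of a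
  member by its value.
\<close>

lemma record_seq_defined_below:
  "record_seq f i = Some t \<Longrightarrow> j \<le> i \<Longrightarrow> \<exists>s. record_seq f j = Some s \<and> s + (i - j) \<le> t"
proof (induction i arbitrary: t)
  case (Suc i)
  show ?case
  proof (cases "j = Suc i")
    case False
    then have "j \<le> i" using Suc.prems by simp
    from Suc.prems(1) obtain s where s: "record_seq f i = Some s" "s < t"
      using record_seq_SucD by blast
    from Suc.IH[OF s(1) \<open>j \<le> i\<close>] s(2) \<open>j \<le> i\<close> show ?thesis
      by (auto simp: Suc_diff_le)
  qed (use Suc.prems in simp)
qed simp

lemma inj_on_records: "inj_on f (records f)"
proof (rule inj_onI)
  fix s t assume "s \<in> records f" "t \<in> records f" "f s = f t"
  then show "s = t" by (cases s t rule: linorder_cases) (auto simp: records_def)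
qed

section \<open>The exponent sets as sets of records\<close>

lemma fraction_between_iff:
  fixes u w e :: int and k r c :: nat
  assumes "0 < w" and "0 < k" and "0 < c"
  shows "real_of_int u / real_of_int w < real_of_int e / real k \<and> real_of_int e / real k \<le> real r / real c
    \<longleftrightarrow> u * int k < e * w \<and> e * int c \<le> int k * int r"
proof -
  have "real_of_int u / real_of_int w < real_of_int e / real k
      \<longleftrightarrow> real_of_int (u * int k) < real_of_int (e * w)"
    using assms by (simp add: field_simps)
  moreover have "real_of_int e / real k \<le> real r / real c
      \<longleftrightarrow> real_of_int (e * int c) \<le> real_of_int (int k * int r)"
    using assms by (simp add: field_simps)
  ultimately show ?thesis by (simp only: of_int_less_iff of_int_le_iff)
qed

text \<open>
  Both branches of \<open>phi\<close> give the least natural number greater than \<open>r t\<close>.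
\<close>

lemma phi_eq_floor:
  assumes "0 \<le> r"
  shows "phi r t = nat \<lfloor>r * real t\<rfloor> + 1"
proof (cases "r * real t \<in> \<nat>")
  case False
  have "r * real t \<ge> 0" using assms by simp
  then have "r * real t \<noteq> of_int \<lfloor>r * real t\<rfloor>"
    using False by (metis of_nat_in_Nats of_nat_nat zero_le_floor)
  then have "\<lceil>r * real t\<rceil> = \<lfloor>r * real t\<rfloor> + 1" by (simp add: ceiling_altdef)
  then show ?thesis using False \<open>r * real t \<ge> 0\<close> by (simp add: phi_def nat_add_distrib)
qed (simp add: phi_def)

lemma phi_le_iff:
  fixes u w :: int
  assumes "0 \<le> u" and "0 < w"
  shows "phi (real_of_int u / real_of_int w) t \<le> s \<longleftrightarrow> u * int t < int s * w"
proof -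
  define x where "x = real_of_int u / real_of_int w * real t"
  have "x \<ge> 0" using assms by (simp add: x_def)
  have "phi (real_of_int u / real_of_int w) t \<le> s \<longleftrightarrow> \<lfloor>x\<rfloor> < int s"
    using assms \<open>x \<ge> 0\<close>
    by (subst phi_eq_floor, simp, unfold x_def[symmetric]) (simp add: Suc_le_eq nat_less_iff)
  also have "\<dots> \<longleftrightarrow> x < real s" by (simp add: floor_less_iff)
  also have "\<dots> \<longleftrightarrow> real_of_int (u * int t) < real_of_int (int s * w)"
    using assms(2) by (simp add: x_def field_simps)
  also have "\<dots> \<longleftrightarrow> u * int t < int s * w" by (simp only: of_int_less_iff)
  finally show ?thesis .
qed

text \<open>
  For fixed \<open>\<beta>\<close>, the conditions on \<open>\<alpha>\<close> in the first system only bound \<open>\<alpha> c3 - \<beta> r23\<close> from above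
  and require it to be positive, so the least \<open>\<alpha>\<close> that makes it positive is the only one to
  consider. Its value \<open>val_A\<close> is then the exponent of \<open>z\<close> in the smallest \<open>p\<close> for this \<open>\<beta>\<close>. The
  second system is treated in the same way, with \<open>sigma_min\<close> and \<open>val_B\<close>.
\<close>

definition alpha_min :: "nat \<Rightarrow> nat \<Rightarrow> nat \<Rightarrow> nat" where
  "alpha_min c3 r23 \<beta> = phi (real r23 / real c3) \<beta>"

definition val_A :: "nat \<Rightarrow> nat \<Rightarrow> nat \<Rightarrow> int" where
  "val_A c3 r23 \<beta> = int (alpha_min c3 r23 \<beta>) * int c3 - int \<beta> * int r23"

definition sigma_min :: "int \<Rightarrow> int \<Rightarrow> nat \<Rightarrow> nat" where
  "sigma_min \<delta>1 \<delta>2 \<gamma> = phi (real_of_int \<delta>1 / real_of_int \<delta>2) \<gamma>"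

definition val_B :: "nat \<Rightarrow> nat \<Rightarrow> int \<Rightarrow> int \<Rightarrow> nat \<Rightarrow> int" where
  "val_B c3 r23 \<delta>1 \<delta>2 \<gamma> = - int \<gamma> * int c3 + int (sigma_min \<delta>1 \<delta>2 \<gamma>) * int r23"

lemma alpha_min_le_iff:
  "0 < c3 \<Longrightarrow> alpha_min c3 r23 \<beta> \<le> \<alpha> \<longleftrightarrow> 0 < int \<alpha> * int c3 - int \<beta> * int r23"
  using phi_le_iff[of "int r23" "int c3" \<beta> \<alpha>] by (simp add: alpha_min_def mult.commute)

lemma sigma_min_le_iff:
  "0 \<le> \<delta>1 \<Longrightarrow> 0 < \<delta>2 \<Longrightarrow> sigma_min \<delta>1 \<delta>2 \<gamma> \<le> \<sigma> \<longleftrightarrow> 0 < - int \<gamma> * \<delta>1 + int \<sigma> * \<delta>2"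
  using phi_le_iff[of \<delta>1 \<delta>2 \<gamma> \<sigma>] by (simp add: sigma_min_def mult.commute)

lemma ex_systemA_iff:
  assumes "0 < c3"
  shows "(\<exists>\<alpha>. systemA c3 r23 (alpha_min c3 r23 \<beta>', \<beta>') (\<alpha>, \<beta>))
    \<longleftrightarrow> \<beta>' < \<beta> \<and> val_A c3 r23 \<beta> < val_A c3 r23 \<beta>'"
proof
  assume "\<exists>\<alpha>. systemA c3 r23 (alpha_min c3 r23 \<beta>', \<beta>') (\<alpha>, \<beta>)"
  then obtain \<alpha> where \<alpha>: "alpha_min c3 r23 \<beta> \<le> \<alpha>" "\<beta>' < \<beta>"
    "int \<alpha> * int c3 - int \<beta> * int r23 < val_A c3 r23 \<beta>'"
    using assms by (auto simp: alpha_min_le_iff val_A_def)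
  have "val_A c3 r23 \<beta> \<le> int \<alpha> * int c3 - int \<beta> * int r23"
    using \<alpha>(1) by (simp add: val_A_def mult_right_mono)
  with \<alpha> show "\<beta>' < \<beta> \<and> val_A c3 r23 \<beta> < val_A c3 r23 \<beta>'" by simp
next
  assume "\<beta>' < \<beta> \<and> val_A c3 r23 \<beta> < val_A c3 r23 \<beta>'"
  then show "\<exists>\<alpha>. systemA c3 r23 (alpha_min c3 r23 \<beta>', \<beta>') (\<alpha>, \<beta>)"
    using alpha_min_le_iff[OF assms, of r23 \<beta> "alpha_min c3 r23 \<beta>"]
    by (intro exI[of _ "alpha_min c3 r23 \<beta>"]) (simp add: val_A_def)
qed

lemma seqA_eq_record_seq:
  assumes "0 < c3"
  shows "seqA c3 r23 i =
    map_option (\<lambda>\<beta>. (alpha_min c3 r23 \<beta>, \<beta>)) (record_seq (val_A c3 r23) i)"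
proof (induction i)
  case 0
  then show ?case by (simp add: alpha_min_def phi_def)
next
  case (Suc i)
  show ?case
  proof (cases "record_seq (val_A c3 r23) i")
    case (Some \<beta>')
    have "(\<exists>\<alpha> \<beta>. systemA c3 r23 (alpha_min c3 r23 \<beta>', \<beta>') (\<alpha>, \<beta>))
        \<longleftrightarrow> (\<exists>\<beta>. \<beta>' < \<beta> \<and> val_A c3 r23 \<beta> < val_A c3 r23 \<beta>')"
      unfolding ex_systemA_iff[OF assms, symmetric] by (rule ex_comm)
    then show ?thesis
      using Suc Some by (simp add: ex_systemA_iff[OF assms] alpha_min_def[symmetric] Let_def
          del: systemA.simps)
  qed (use Suc in simp)
qed

lemma ex_systemB_iff:
  assumes "0 \<le> \<delta>1" and "0 < \<delta>2"
  shows "(\<exists>\<sigma>. systemB c3 r23 \<delta>1 \<delta>2 (\<gamma>', sigma_min \<delta>1 \<delta>2 \<gamma>') (\<gamma>, \<sigma>))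
    \<longleftrightarrow> \<gamma>' < \<gamma> \<and> val_B c3 r23 \<delta>1 \<delta>2 \<gamma> < val_B c3 r23 \<delta>1 \<delta>2 \<gamma>'"
proof
  assume "\<exists>\<sigma>. systemB c3 r23 \<delta>1 \<delta>2 (\<gamma>', sigma_min \<delta>1 \<delta>2 \<gamma>') (\<gamma>, \<sigma>)"
  then obtain \<sigma> where \<sigma>: "sigma_min \<delta>1 \<delta>2 \<gamma> \<le> \<sigma>" "\<gamma>' < \<gamma>"
    "- int \<gamma> * int c3 + int \<sigma> * int r23 < val_B c3 r23 \<delta>1 \<delta>2 \<gamma>'"
    using assms by (auto simp: sigma_min_le_iff val_B_def)
  have "val_B c3 r23 \<delta>1 \<delta>2 \<gamma> \<le> - int \<gamma> * int c3 + int \<sigma> * int r23"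
    using \<sigma>(1) by (simp add: val_B_def mult_right_mono)
  with \<sigma> show "\<gamma>' < \<gamma> \<and> val_B c3 r23 \<delta>1 \<delta>2 \<gamma> < val_B c3 r23 \<delta>1 \<delta>2 \<gamma>'" by simp
next
  assume "\<gamma>' < \<gamma> \<and> val_B c3 r23 \<delta>1 \<delta>2 \<gamma> < val_B c3 r23 \<delta>1 \<delta>2 \<gamma>'"
  then show "\<exists>\<sigma>. systemB c3 r23 \<delta>1 \<delta>2 (\<gamma>', sigma_min \<delta>1 \<delta>2 \<gamma>') (\<gamma>, \<sigma>)"
    using sigma_min_le_iff[OF assms, of \<gamma> "sigma_min \<delta>1 \<delta>2 \<gamma>"]
    by (intro exI[of _ "sigma_min \<delta>1 \<delta>2 \<gamma>"]) (simp add: val_B_def)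
qed

lemma seqB_eq_record_seq:
  assumes "0 \<le> \<delta>1" and "0 < \<delta>2"
  shows "seqB c3 r23 \<delta>1 \<delta>2 i =
    map_option (\<lambda>\<gamma>. (\<gamma>, sigma_min \<delta>1 \<delta>2 \<gamma>)) (record_seq (val_B c3 r23 \<delta>1 \<delta>2) i)"
proof (induction i)
  case 0
  then show ?case by (simp add: sigma_min_def phi_def)
next
  case (Suc i)
  show ?case
  proof (cases "record_seq (val_B c3 r23 \<delta>1 \<delta>2) i")
    case (Some \<gamma>')
    then show ?thesis
      using Suc by (simp add: ex_systemB_iff[OF assms] sigma_min_def[symmetric] Let_def
          del: systemB.simps)
  qed (use Suc in simp)
qed

text \<open>
  The greatest index \<open>t\<close> with \<open>\<beta>\<^sub>t < \<epsilon>\<close> exists since \<open>\<beta>\<^sub>0 = 0 < \<epsilon>\<close> and \<open>\<beta>\<^sub>i \<ge> i\<close>, and \<open>\<beta>\<^sub>i\<close>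
  increases, so cutting the sequence at \<open>t\<close> is the same as bounding \<open>\<beta>\<close> by \<open>\<epsilon>\<close>.
\<close>

lemma setA_eq_records:
  assumes "0 < c3" and "0 < \<epsilon>"
  shows "setA c3 r23 \<epsilon> =
    (\<lambda>\<beta>. (alpha_min c3 r23 \<beta>, \<beta>)) ` {\<beta> \<in> records (val_A c3 r23). \<beta> < \<epsilon>}"
proof -
  let ?s = "record_seq (val_A c3 r23)"
  define P where "P = (\<lambda>i. \<exists>\<beta>. ?s i = Some \<beta> \<and> \<beta> < \<epsilon>)"
  define t where "t = Greatest P"
  have P_iff: "(\<exists>\<alpha> \<beta>. seqA c3 r23 i = Some (\<alpha>, \<beta>) \<and> \<beta> < \<epsilon>) \<longleftrightarrow> P i" for i
    using assms(1) by (auto simp: seqA_eq_record_seq P_def)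
  have bound: "i \<le> \<epsilon>" if "P i" for i
  proof -
    obtain \<beta> where \<beta>: "?s i = Some \<beta>" "\<beta> < \<epsilon>" using \<open>P i\<close> by (auto simp: P_def)
    from record_seq_defined_below[OF \<beta>(1), of 0] \<beta>(2) show ?thesis by auto
  qed
  have "P 0" using assms(2) by (simp add: P_def)
  then have "P t" unfolding t_def by (rule GreatestI_nat) (rule bound)
  have below: "i \<le> t \<longleftrightarrow> \<beta> < \<epsilon>" if i: "?s i = Some \<beta>" for i \<beta>
  proof
    assume "i \<le> t"
    obtain \<beta>' where \<beta>': "?s t = Some \<beta>'" "\<beta>' < \<epsilon>" using \<open>P t\<close> by (auto simp: P_def)
    from record_seq_defined_below[OF \<beta>'(1) \<open>i \<le> t\<close>] \<beta>'(2) i show "\<beta> < \<epsilon>" by auto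
  next
    assume "\<beta> < \<epsilon>"
    then have "P i" using i by (simp add: P_def)
    then show "i \<le> t" unfolding t_def by (rule Greatest_le_nat) (rule bound)
  qed
  have "setA c3 r23 \<epsilon> = {v. \<exists>i\<le>t. seqA c3 r23 i = Some v}"
    by (simp add: setA_def P_iff t_def)
  also have "\<dots> = (\<lambda>\<beta>. (alpha_min c3 r23 \<beta>, \<beta>)) ` {\<beta> \<in> records (val_A c3 r23). \<beta> < \<epsilon>}"
  proof (intro set_eqI iffI; elim CollectE imageE exE conjE)
    fix v i assume "i \<le> t" "seqA c3 r23 i = Some v"
    then obtain \<beta> where "?s i = Some \<beta>" "v = (alpha_min c3 r23 \<beta>, \<beta>)"
      using assms(1) by (auto simp: seqA_eq_record_seq)
    with below \<open>i \<le> t\<close> show "v \<in> (\<lambda>\<beta>. (alpha_min c3 r23 \<beta>, \<beta>)) ` {\<beta> \<in> records (val_A c3 r23). \<beta> < \<epsilon>}"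
      by (auto intro: record_seq_in_records)
  next
    fix v \<beta> assume v: "v = (alpha_min c3 r23 \<beta>, \<beta>)" and \<beta>: "\<beta> \<in> records (val_A c3 r23)" "\<beta> < \<epsilon>"
    obtain i where "?s i = Some \<beta>" using records_in_record_seq[OF \<beta>(1)] by blast
    with below \<beta>(2) v assms(1) show "v \<in> {v. \<exists>i\<le>t. seqA c3 r23 i = Some v}"
      by (auto simp: seqA_eq_record_seq)
  qed
  finally show ?thesis .
qed

lemma setB_eq_records:
  assumes "0 \<le> \<delta>1" and "0 < \<delta>2"
  shows "setB c3 r23 \<delta>1 \<delta>2 =
    (\<lambda>\<gamma>. (\<gamma>, sigma_min \<delta>1 \<delta>2 \<gamma>)) ` records (val_B c3 r23 \<delta>1 \<delta>2)"
  using assms by (auto simp: setB_def seqB_eq_record_seq records_eq_range_record_seq)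

section \<open>Semigroups with two generators\<close>

lemma semigroup_gen_pair: "s \<in> semigroup_gen {a, b} \<longleftrightarrow> (\<exists>i j. s = i * a + j * b)"
proof
  show "\<exists>i j. s = i * a + j * b" if "s \<in> semigroup_gen {a, b}"
    using that
  proof induction
    case zero
    then show ?case by (intro exI[of _ 0]) simp
  next
    case (add x s)
    then obtain i j where "s = i * a + j * b" by blast
    with add have "x + s = Suc i * a + j * b \<or> x + s = i * a + Suc j * b" by auto
    then show ?case by blast
  qed
next
  have step: "k * x + s \<in> semigroup_gen {a, b}" if "x \<in> {a, b}" "s \<in> semigroup_gen {a, b}" for k x s
    using that by (induction k) (auto simp: add.assoc intro: semigroup_gen.add)
  assume "\<exists>i j. s = i * a + j * b"
  then obtain i j where "s = i * a + j * b" by blast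
  then show "s \<in> semigroup_gen {a, b}"
    using step[of a "j * b" i] step[of b 0 j] semigroup_gen.zero by simp
qed

lemma least_multiple_pos:
  assumes "0 < a"
  shows "0 < least_multiple n {a, b}"
proof -
  have "0 < a \<and> a * n \<in> semigroup_gen {a, b}"
    unfolding semigroup_gen_pair using assms by (intro conjI exI[of _ n] exI[of _ 0]) simp_all
  then show ?thesis unfolding least_multiple_def by (rule LeastI2) simp
qed

lemma least_multiple_le:
  assumes "0 < c" and "c * n = i * a + j * b"
  shows "least_multiple n {a, b} \<le> c"
  unfolding least_multiple_def
  using assms by (intro Least_le) (auto simp: semigroup_gen_pair)

section \<open>Relations between the three generators\<close>

text \<open>
  The numbers \<open>hx\<close>, \<open>hy\<close>, \<open>hz\<close> are the exponents in \<open>h = y\<^sup>h\<^sup>y - x\<^sup>h\<^sup>x z\<^sup>h\<^sup>z\<close>.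
\<close>

locale three_generators = weights n1 n2 n3 for n1 n2 n3 +
  fixes c1 c2 c3 r13 r21 r23 r31 \<alpha>h \<beta>h hx hy hz :: nat
  assumes n1_pos: "0 < n1" and n12: "n1 < n2" and n23: "n2 < n3"
    and c1: "c1 = least_multiple n1 {n2, n3}"
    and c2: "c2 = least_multiple n2 {n1, n3}"
    and c3: "c3 = least_multiple n3 {n1, n2}"
    and rel1: "c1 * n1 = r13 * n3"
    and rel2: "c2 * n2 = r21 * n1 + r23 * n3"
    and rel3: "c3 * n3 = r31 * n1"
    and r23_less: "r23 < c3"
    and deg2: "r21 + r23 < c2"
    and hx_def: "hx = (n3 - n2) div gcd (n2 - n1) (n3 - n1)"
    and hy_def: "hy = (n3 - n1) div gcd (n2 - n1) (n3 - n1)"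
    and hz_def: "hz = (n2 - n1) div gcd (n2 - n1) (n3 - n1)"
    and \<alpha>h_pos: "0 < \<alpha>h" and \<beta>h_pos: "0 < \<beta>h"
    and hx_eq: "hx = \<alpha>h * c1 + \<beta>h * r21"
    and hy_eq: "hy = \<beta>h * c2"
    and hz_eq: "int hz = - int \<alpha>h * int c3 + int \<beta>h * int r23"
begin

abbreviation \<delta>1 :: int where "\<delta>1 \<equiv> int c1 - int c3"
abbreviation \<delta>2 :: int where "\<delta>2 \<equiv> int c2 - int r21 - int r23"
definition \<epsilon> :: nat where "\<epsilon> = eps c3 r23 \<delta>1 \<delta>2"

lemma c_pos: "0 < c1" "0 < c2" "0 < c3"
  using n1_pos n12 by (simp_all add: c1 c2 c3 least_multiple_pos)

text \<open>
  The minimality of \<open>c1\<close> and \<open>c3\<close>, each applied to the relation that defines the other.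
\<close>

lemma c1_c3: "c1 * n1 = c3 * n3"
proof (rule antisym)
  have "0 < r31"
  proof (rule ccontr)
    assume "\<not> 0 < r31"
    then have "c3 * n3 = 0" using rel3 by simp
    then show False using c_pos n23 by simp
  qed
  then have "c1 \<le> r31"
    unfolding c1 using rel3 by (intro least_multiple_le[of _ _ 0 _ c3]) simp_all
  then show "c1 * n1 \<le> c3 * n3" using rel3 by simp
next
  have "0 < r13"
  proof (rule ccontr)
    assume "\<not> 0 < r13"
    then have "c1 * n1 = 0" using rel1 by simp
    then show False using c_pos n1_pos by simp
  qed
  then have "c3 \<le> r13"
    unfolding c3 using rel1 by (intro least_multiple_le[of _ _ c1 _ 0]) simp_all
  then show "c3 * n3 \<le> c1 * n1" using rel1 by simp
qed

lemma int_relations: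
  "int c2 * int n2 = int r21 * int n1 + int r23 * int n3"
  "int c1 * int n1 = int c3 * int n3"
  using rel2 c1_c3 by (metis of_nat_add of_nat_mult)+

lemma delta_pos: "0 < \<delta>1" "0 < \<delta>2"
proof -
  have "c3 * n1 < c1 * n1"
    unfolding c1_c3 using c_pos n12 n23 by simp
  then show "0 < \<delta>1" by simp
  show "0 < \<delta>2" using deg2 by simp
qed

text \<open>
  Subtracting multiples of \<open>(r21, -c2, r23)\<close> and \<open>(c1, 0, -c3)\<close> brings a relation to the form
  \<open>p0 n1 + q0 n2 + r0 n3 = 0\<close> with \<open>0 \<le> p0 < c1\<close> and \<open>0 \<le> q0 < c2\<close>. If \<open>r0 < 0\<close>, then \<open>-r0 \<ge> c3\<close>
  by the minimality of \<open>c3\<close>. Replacing \<open>c3 n3\<close> by \<open>c1 n1\<close> turns the relation into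
  \<open>q0 n2 = (c1 - p0) n1 + (-r0 - c3) n3\<close>, which contradicts the minimality of \<open>c2\<close>. So \<open>r0 \<ge> 0\<close>,
  and all three summands vanish.
\<close>

lemma relation_lattice:
  fixes p q r :: int
  assumes rel: "p * int n1 + q * int n2 + r * int n3 = 0"
  shows "\<exists>s t. p = s * int c1 + t * int r21 \<and> q = - t * int c2 \<and> r = - s * int c3 + t * int r23"
proof -
  define t where "t = - (q div int c2)"
  define q0 where "q0 = q mod int c2"
  have q0: "q0 = q + t * int c2"
    by (simp add: q0_def t_def minus_div_mult_eq_mod[symmetric])
  have q0_bounds: "0 \<le> q0" "q0 < int c2" using c_pos by (simp_all add: q0_def)
  define s where "s = (p - t * int r21) div int c1"
  define p0 where "p0 = (p - t * int r21) mod int c1"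
  have p0: "p0 = p - t * int r21 - s * int c1"
    by (simp add: p0_def s_def minus_div_mult_eq_mod[symmetric])
  have p0_bounds: "0 \<le> p0" "p0 < int c1" using c_pos by (simp_all add: p0_def)
  define r0 where "r0 = r - t * int r23 + s * int c3"
  have "p0 * int n1 + q0 * int n2 + r0 * int n3
      = (p * int n1 + q * int n2 + r * int n3)
        + t * (int c2 * int n2 - (int r21 * int n1 + int r23 * int n3))
        + s * (int c3 * int n3 - int c1 * int n1)"
    unfolding p0 q0 r0_def by algebra
  then have rel0: "p0 * int n1 + q0 * int n2 + r0 * int n3 = 0"
    using rel int_relations by simp
  have "0 \<le> r0"
  proof (rule ccontr)
    assume "\<not> 0 \<le> r0"
    then have r0: "nat (- r0) > 0" "int (nat (- r0)) = - r0" by auto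
    have eq: "nat (- r0) * n3 = nat p0 * n1 + nat q0 * n2"
    proof -
      have "int (nat (- r0) * n3) = int (nat p0 * n1 + nat q0 * n2)"
        using p0_bounds q0_bounds rel0 r0 by simp
      then show ?thesis by (simp only: of_nat_eq_iff)
    qed
    then have "c3 \<le> nat (- r0)"
      unfolding c3 using r0 by (intro least_multiple_le) auto
    then have r0': "int (nat (- r0) - c3) = - r0 - int c3" using r0 by simp
    have "int (nat q0 * n2) = int ((c1 - nat p0) * n1 + (nat (- r0) - c3) * n3)"
    proof -
      have c1p0: "int (c1 - nat p0) = int c1 - p0" using p0_bounds by simp
      have natq0: "int (nat q0) = q0" using q0_bounds by simp
      show ?thesis
        unfolding of_nat_mult of_nat_add c1p0 natq0 r0' using rel0 int_relations(2) by algebra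
    qed
    then have eq2: "nat q0 * n2 = (c1 - nat p0) * n1 + (nat (- r0) - c3) * n3"
      by (simp only: of_nat_eq_iff)
    have "0 < (c1 - nat p0) * n1" using p0_bounds n1_pos by simp
    then have "0 < nat q0" using eq2 by (cases "nat q0") auto
    then have "c2 \<le> nat q0" unfolding c2 using eq2 by (intro least_multiple_le)
    then show False using q0_bounds by simp
  qed
  moreover have "0 \<le> p0 * int n1" "0 \<le> q0 * int n2" using p0_bounds q0_bounds by simp_all
  moreover have "0 \<le> r0 * int n3" using \<open>0 \<le> r0\<close> by simp
  ultimately have "p0 * int n1 = 0" "q0 * int n2 = 0" "r0 * int n3 = 0" using rel0 by linarith+
  then have "p0 = 0" "q0 = 0" "r0 = 0" using n1_pos n12 n23 by simp_all
  then show ?thesis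
    using p0 q0 r0_def by (intro exI[of _ s] exI[of _ t]) simp
qed

lemma h_pos: "0 < hx" "0 < hy" "0 < hz"
  using n12 n23
  by (auto simp: hx_eq hy_eq hz_def \<alpha>h_pos \<beta>h_pos c_pos div_greater_zero_iff intro!: gcd_le1_nat)

lemma h_degree: "hx + hz = hy"
proof -
  let ?d = "gcd (n2 - n1) (n3 - n1)"
  have dvd: "?d dvd n2 - n1" "?d dvd n3 - n1" by simp_all
  then have "?d dvd (n3 - n1) - (n2 - n1)" by (rule dvd_diff_nat[rotated])
  moreover have "(n3 - n1) - (n2 - n1) = n3 - n2" using n12 by simp
  ultimately have "?d dvd n3 - n2" by simp
  then have "hx + hz = ((n3 - n2) + (n2 - n1)) div ?d"
    using dvd by (simp add: hx_def hz_def)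
  also have "(n3 - n2) + (n2 - n1) = n3 - n1" using n12 n23 by simp
  finally show ?thesis by (simp add: hy_def)
qed

text \<open>
  The binomial \<open>h\<close> is homogeneous: \<open>\<alpha>h / \<beta>h = \<delta>2 / \<delta>1\<close>.
\<close>

lemma slope_h: "int \<alpha>h * \<delta>1 = int \<beta>h * \<delta>2"
proof -
  have "int hx + int hz = int hy" using h_degree by (metis of_nat_add)
  then show ?thesis by (simp add: hx_eq hy_eq hz_eq algebra_simps)
qed

text \<open>
  This is \<open>\<delta>2 / \<delta>1 < r23 / c3\<close>. It holds because \<open>\<delta>2 / \<delta>1 = \<alpha>h / \<beta>h\<close> and \<open>\<beta>h r23 - \<alpha>h c3 = hz\<close> is
  positive.
\<close>

lemma slope_less: "\<delta>2 * int c3 < int r23 * \<delta>1"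
proof -
  have "int \<alpha>h * int c3 < int \<beta>h * int r23" using h_pos(3) hz_eq by linarith
  then have "int \<alpha>h * int c3 * \<delta>1 < int \<beta>h * int r23 * \<delta>1"
    using delta_pos(1) by (rule mult_strict_right_mono)
  moreover have "int \<alpha>h * int c3 * \<delta>1 = int \<beta>h * (\<delta>2 * int c3)"
    using arg_cong[OF slope_h, of "\<lambda>x. x * int c3"] by (simp only: ac_simps)
  ultimately have "int \<beta>h * (\<delta>2 * int c3) < int \<beta>h * (int r23 * \<delta>1)"
    by (simp only: mult.assoc)
  then show ?thesis using \<beta>h_pos by (simp only: mult_less_cancel_left_pos of_nat_0_less_iff)
qed

text \<open>
  A difference \<open>(u, -q, r)\<close> of exponent vectors with equal weight and degree satisfies
  \<open>q (n2 - n1) = r (n3 - n1)\<close>, that is, \<open>q hz = r hy\<close>, where \<open>hy\<close> and \<open>hz\<close> are coprime.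
\<close>

lemma similar_differ_by_multiple_of_h:
  assumes "similar (i, j, k) (i', j', k')" and "k \<le> k'"
  shows "\<exists>t. i' = i + t * hx \<and> j = j' + t * hy \<and> k' = k + t * hz"
proof -
  let ?d = "gcd (n2 - n1) (n3 - n1)"
  have d: "int ?d \<noteq> 0" using n12 by simp
  have a: "n2 - n1 = hz * ?d" and b: "n3 - n1 = hy * ?d"
    by (simp_all add: hz_def hy_def)
  have cop: "coprime hz hy"
    unfolding hz_def hy_def using n12 by (intro div_gcd_coprime) simp
  define q r where "q = int j - int j'" and "r = int k' - int k"
  have deg: "int i + int j + int k = int i' + int j' + int k'"
    and wt: "int i * int n1 + int j * int n2 + int k * int n3
        = int i' * int n1 + int j' * int n2 + int k' * int n3"
    using assms(1) by (auto simp: similar_def simp flip: of_nat_add of_nat_mult)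
  have i: "int i = int i' + int j' + int k' - int j - int k" using deg by simp
  have "q * (int n2 - int n1) = r * (int n3 - int n1)"
    using wt unfolding i q_def r_def by (simp add: algebra_simps)
  moreover have "int n2 - int n1 = int hz * int ?d" "int n3 - int n1 = int hy * int ?d"
    using a b n12 n23 by (metis of_nat_diff of_nat_mult less_imp_le less_trans)+
  ultimately have "(q * int hz) * int ?d = (r * int hy) * int ?d" by (simp only: mult.assoc)
  then have qr: "q * int hz = r * int hy" using d by (metis mult_cancel_right)
  then have "int hz dvd r * int hy" by (metis dvd_triv_right)
  then have "int hz dvd r" using cop by (simp add: coprime_dvd_mult_left_iff)
  then obtain t where t: "r = int hz * t" by blast
  have "0 \<le> int hz * t" using assms(2) t by (simp add: r_def)
  then have "0 \<le> t" using h_pos by (simp add: zero_le_mult_iff)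
  have q: "q = t * int hy" using qr h_pos by (simp add: t)
  obtain u where u: "t = int u" using \<open>0 \<le> t\<close> nonneg_int_cases by blast
  have "int i' = int i + int u * (int hy - int hz)"
    using deg q t unfolding q_def r_def u by (simp add: algebra_simps)
  moreover have "int hy - int hz = int hx" using h_degree by linarith
  ultimately have "int i' = int (i + u * hx)" by simp
  moreover have "int j = int (j' + u * hy)" using q by (simp add: q_def u)
  moreover have "int k' = int (k + u * hz)" using t by (simp add: r_def u mult.commute)
  ultimately show ?thesis by (intro exI[of _ u]) (simp only: of_nat_eq_iff)
qed

definition h_poly :: "'k::field poly3" where
  "h_poly = mon 0 hy 0 - mon hx 0 hz"

text \<open>
  The telescoping sum behind the divisibility of \<open>Y\<^sup>t - Z\<^sup>t\<close> by \<open>Y - Z\<close>.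
\<close>

lemma multiple_of_h_in_span:
  "Poly_Mapping.single (i, j + t * hy, k) 1 - Poly_Mapping.single (i + t * hx, j, k + t * hz) 1
    \<in> ideal.span {h_poly :: 'k::field poly3}"
proof (induction t arbitrary: i k)
  case 0
  then show ?case by (simp add: ideal.span_zero)
next
  case (Suc t)
  have "Poly_Mapping.single (i, j + t * hy, k) 1 * (h_poly :: 'k poly3)
      = Poly_Mapping.single (i, j + Suc t * hy, k) 1
        - Poly_Mapping.single (i + hx, j + t * hy, k + hz) 1"
    by (simp add: h_poly_def mon_def right_diff_distrib mult_single ac_simps)
  then have "Poly_Mapping.single (i, j + Suc t * hy, k) 1
        - Poly_Mapping.single (i + hx, j + t * hy, k + hz) 1 \<in> ideal.span {h_poly :: 'k poly3}"
    by (metis ideal.span_base ideal.span_scale singletonI)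
  from ideal.span_add[OF this Suc.IH[of "i + hx" "k + hz"]] show ?case
    by (simp add: ac_simps)
qed

lemma similar_diff_in_span:
  assumes "similar m m'"
  shows "Poly_Mapping.single m 1 - Poly_Mapping.single m' 1 \<in> ideal.span {h_poly :: 'k::field poly3}"
proof -
  have le: "Poly_Mapping.single (i, j, k) 1 - Poly_Mapping.single (i', j', k') 1
      \<in> ideal.span {h_poly :: 'k poly3}"
    if sim: "similar (i, j, k) (i', j', k')" and "k \<le> k'" for i j k i' j' k'
    using similar_differ_by_multiple_of_h[OF that] multiple_of_h_in_span by auto
  obtain i j k i' j' k' where m: "m = (i, j, k)" "m' = (i', j', k')"
    by (cases m; cases m')
  show ?thesis
  proof (cases "k \<le> k'")
    case True
    then show ?thesis using le assms m by simp
  next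
    case False
    then have "Poly_Mapping.single m' 1 - Poly_Mapping.single m 1 \<in> ideal.span {h_poly :: 'k poly3}"
      using le[of i' j' k' i j k] assms m by (simp add: similar_def)
    from ideal.span_neg[OF this] show ?thesis by simp
  qed
qed

section \<open>Nonmaximal monomials\<close>

lemma eps_spec:
  shows eps_pos: "0 < \<epsilon>"
    and eps_fraction: "\<exists>e. \<delta>2 * int \<epsilon> < e * \<delta>1 \<and> e * int c3 \<le> int \<epsilon> * int r23"
    and eps_least: "0 < k \<Longrightarrow> \<delta>2 * int k < e * \<delta>1 \<Longrightarrow> e * int c3 \<le> int k * int r23 \<Longrightarrow> \<epsilon> \<le> k"
proof -
  define Q where "Q = (\<lambda>k. 0 < k \<and> (\<exists>e. \<delta>2 * int k < e * \<delta>1 \<and> e * int c3 \<le> int k * int r23))"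
  have eps: "\<epsilon> = (LEAST k. Q k)"
    unfolding \<epsilon>_def eps_def Q_def
    by (rule arg_cong[of _ _ Least]) (use fraction_between_iff[OF delta_pos(1) _ c_pos(3)] in blast)
  have "Q c3" using slope_less c_pos by (auto simp: Q_def intro!: exI[of _ "int r23"])
  then have "Q \<epsilon>" unfolding eps by (rule LeastI)
  then show "0 < \<epsilon>" and "\<exists>e. \<delta>2 * int \<epsilon> < e * \<delta>1 \<and> e * int c3 \<le> int \<epsilon> * int r23"
    by (simp_all add: Q_def)
  show "\<epsilon> \<le> k" if "0 < k" "\<delta>2 * int k < e * \<delta>1" "e * int c3 \<le> int k * int r23"
  proof -
    have "Q k" using that unfolding Q_def by blast
    then show ?thesis unfolding eps by (rule Least_le)
  qed
qed

lemma slope_above: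
  assumes "0 < int \<alpha> * int c3 - int \<beta> * int r23"
  shows "int \<beta> * \<delta>2 < int \<alpha> * \<delta>1"
proof -
  have "int \<beta> * (\<delta>2 * int c3) \<le> int \<beta> * (int r23 * \<delta>1)"
    using slope_less by (intro mult_left_mono) auto
  also have "\<dots> = (int \<beta> * int r23) * \<delta>1" by (simp only: mult.assoc)
  also have "\<dots> < (int \<alpha> * int c3) * \<delta>1"
    using assms delta_pos(1) by (intro mult_strict_right_mono) simp_all
  finally have "int c3 * (int \<beta> * \<delta>2) < int c3 * (int \<alpha> * \<delta>1)" by (simp only: ac_simps)
  then show ?thesis using c_pos by (simp only: mult_less_cancel_left_pos of_nat_0_less_iff)
qed

lemma slope_below:
  assumes "0 < - int \<gamma> * \<delta>1 + int \<sigma> * \<delta>2"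
  shows "int \<gamma> * int c3 < int \<sigma> * int r23"
proof -
  have less: "int \<gamma> * \<delta>1 < int \<sigma> * \<delta>2" using assms by simp
  then have "(int \<gamma> * \<delta>1) * int c3 < (int \<sigma> * \<delta>2) * int c3"
    using c_pos by (intro mult_strict_right_mono) simp_all
  also have "\<dots> = int \<sigma> * (\<delta>2 * int c3)" by (simp only: mult.assoc)
  also have "\<dots> \<le> int \<sigma> * (int r23 * \<delta>1)"
    using slope_less by (intro mult_left_mono) auto
  finally have "\<delta>1 * (int \<gamma> * int c3) < \<delta>1 * (int \<sigma> * int r23)" by (simp only: ac_simps)
  then show ?thesis using delta_pos(1) by (simp only: mult_less_cancel_left_pos)
qed

text \<open>
  The degree changes by \<open>s \<delta>1 - t \<delta>2\<close> along the relation \<open>s (c1, 0, -c3) + t (r21, -c2, r23)\<close>.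
\<close>

lemma nonmax_iff_lattice:
  "nonmax (i, j, k) \<longleftrightarrow> (\<exists>s t. t * \<delta>2 < s * \<delta>1 \<and> 0 \<le> int i + s * int c1 + t * int r21 \<and>
     0 \<le> int j - t * int c2 \<and> 0 \<le> int k - s * int c3 + t * int r23)"
  (is "_ \<longleftrightarrow> (\<exists>s t. ?R s t)")
proof
  assume "nonmax (i, j, k)"
  then obtain m' where m': "wt m' = wt (i, j, k)" "total_degree (i, j, k) < total_degree m'"
    unfolding nonmax_def by blast
  obtain i' j' k' where eq: "m' = (i', j', k')" by (cases m')
  have "int (i' * n1 + j' * n2 + k' * n3) = int (i * n1 + j * n2 + k * n3)"
    using m'(1) by (simp add: eq)
  then have wt: "int i' * int n1 + int j' * int n2 + int k' * int n3
      = int i * int n1 + int j * int n2 + int k * int n3"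
    by (simp only: of_nat_add of_nat_mult)
  have deg: "int i + int j + int k < int i' + int j' + int k'"
    using m'(2) by (simp add: eq)
  have "(int i' - int i) * int n1 + (int j' - int j) * int n2 + (int k' - int k) * int n3 = 0"
    using wt by algebra
  from relation_lattice[OF this] obtain s t where st: "int i' - int i = s * int c1 + t * int r21"
    "int j' - int j = - t * int c2" "int k' - int k = - s * int c3 + t * int r23" by blast
  have "s * \<delta>1 - t * \<delta>2 = (int i' - int i) + (int j' - int j) + (int k' - int k)"
    unfolding st by algebra
  then have "t * \<delta>2 < s * \<delta>1" using deg by simp
  moreover have "int i' = int i + s * int c1 + t * int r21" "int j' = int j - t * int c2"
    "int k' = int k - s * int c3 + t * int r23" using st by simp_all
  ultimately have "?R s t" by (metis of_nat_0_le_iff)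
  then show "\<exists>s t. ?R s t" by blast
next
  assume "\<exists>s t. ?R s t"
  then obtain s t where R: "?R s t" by blast
  define i' where "i' = nat (int i + s * int c1 + t * int r21)"
  define j' where "j' = nat (int j - t * int c2)"
  define k' where "k' = nat (int k - s * int c3 + t * int r23)"
  have int: "int i' = int i + s * int c1 + t * int r21" "int j' = int j - t * int c2"
    "int k' = int k - s * int c3 + t * int r23" using R by (simp_all add: i'_def j'_def k'_def)
  have "int (i' * n1 + j' * n2 + k' * n3) = int (i * n1 + j * n2 + k * n3)"
    unfolding of_nat_add of_nat_mult int using int_relations by algebra
  then have "wt (i', j', k') = wt (i, j, k)" by (simp only: of_nat_eq_iff wt.simps)
  moreover have "int i' + int j' + int k' = int i + int j + int k + (s * \<delta>1 - t * \<delta>2)"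
    unfolding int by algebra
  then have "total_degree (i, j, k) < total_degree (i', j', k')" using R by simp
  ultimately show "nonmax (i, j, k)" unfolding nonmax_def by blast
qed

definition A :: "(nat \<times> nat) set" where "A = setA c3 r23 \<epsilon>"
definition B :: "(nat \<times> nat) set" where "B = setB c3 r23 \<delta>1 \<delta>2"
definition expo_g :: expo where "expo_g = (0, \<epsilon> * c2, 0)"
definition expo_p :: "nat \<Rightarrow> nat \<Rightarrow> expo" where "expo_p \<alpha> \<beta> = (0, \<beta> * c2, \<alpha> * c3 - \<beta> * r23)"
definition expo_q :: "nat \<Rightarrow> nat \<Rightarrow> expo" where
  "expo_q \<gamma> \<sigma> = (\<gamma> * c1 + \<sigma> * r21, 0, \<sigma> * r23 - \<gamma> * c3)"

definition generator_expos :: "expo set" where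
  "generator_expos = insert expo_g (case_prod expo_p ` A \<union> case_prod expo_q ` B)"

lemma A_eq: "A = (\<lambda>\<beta>. (alpha_min c3 r23 \<beta>, \<beta>)) ` {\<beta> \<in> records (val_A c3 r23). \<beta> < \<epsilon>}"
  unfolding A_def by (rule setA_eq_records[OF c_pos(3) eps_pos])

lemma B_eq: "B = (\<lambda>\<gamma>. (\<gamma>, sigma_min \<delta>1 \<delta>2 \<gamma>)) ` records (val_B c3 r23 \<delta>1 \<delta>2)"
  unfolding B_def by (rule setB_eq_records[OF less_imp_le[OF delta_pos(1)] delta_pos(2)])

lemma alpha_min_iff: "alpha_min c3 r23 \<beta> \<le> \<alpha> \<longleftrightarrow> 0 < int \<alpha> * int c3 - int \<beta> * int r23"
  by (rule alpha_min_le_iff[OF c_pos(3)])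

lemma sigma_min_iff: "sigma_min \<delta>1 \<delta>2 \<gamma> \<le> \<sigma> \<longleftrightarrow> 0 < - int \<gamma> * \<delta>1 + int \<sigma> * \<delta>2"
  by (rule sigma_min_le_iff[OF less_imp_le[OF delta_pos(1)] delta_pos(2)])

lemma val_A_pos: "0 < val_A c3 r23 \<beta>"
  using alpha_min_iff[of \<beta> "alpha_min c3 r23 \<beta>"] by (simp add: val_A_def)

lemma val_A_le:
  assumes "0 < int \<alpha> * int c3 - int \<beta> * int r23"
  shows "val_A c3 r23 \<beta> \<le> int \<alpha> * int c3 - int \<beta> * int r23"
proof -
  have "alpha_min c3 r23 \<beta> \<le> \<alpha>" using assms by (simp only: alpha_min_iff)
  then have "int (alpha_min c3 r23 \<beta>) * int c3 \<le> int \<alpha> * int c3" by (intro mult_right_mono) simp_all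
  then show ?thesis by (simp add: val_A_def)
qed

lemma sigma_min_admissible: "0 < - int \<gamma> * \<delta>1 + int (sigma_min \<delta>1 \<delta>2 \<gamma>) * \<delta>2"
  using sigma_min_iff[of \<gamma> "sigma_min \<delta>1 \<delta>2 \<gamma>"] by simp

lemma val_B_pos: "0 < val_B c3 r23 \<delta>1 \<delta>2 \<gamma>"
  using slope_below[OF sigma_min_admissible[of \<gamma>]] by (simp add: val_B_def)

lemma val_B_le:
  assumes "0 < - int \<gamma> * \<delta>1 + int \<sigma> * \<delta>2"
  shows "val_B c3 r23 \<delta>1 \<delta>2 \<gamma> \<le> - int \<gamma> * int c3 + int \<sigma> * int r23"
proof -
  have "sigma_min \<delta>1 \<delta>2 \<gamma> \<le> \<sigma>" using assms by (simp only: sigma_min_iff)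
  then have "int (sigma_min \<delta>1 \<delta>2 \<gamma>) * int r23 \<le> int \<sigma> * int r23" by (intro mult_right_mono) simp_all
  then show ?thesis by (simp add: val_B_def)
qed

lemma A_admissible: "(\<alpha>, \<beta>) \<in> A \<Longrightarrow> 0 < int \<alpha> * int c3 - int \<beta> * int r23"
  using val_A_pos by (auto simp: A_eq val_A_def)

lemma B_admissible: "(\<gamma>, \<sigma>) \<in> B \<Longrightarrow> 0 < - int \<gamma> * \<delta>1 + int \<sigma> * \<delta>2"
  using sigma_min_admissible unfolding B_eq by blast

text \<open>
  The monomials of larger degree are \<open>x\<^sup>u z\<^sup>v\<close> for \<open>g\<close>, where the exponents belong to a fraction
  \<open>e / \<epsilon>\<close> between \<open>\<delta>2 / \<delta>1\<close> and \<open>r23 / c3\<close>, a power of \<open>x\<close> for \<open>p\<close> and a power of \<open>y\<close> for \<open>q\<close>.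
\<close>

lemma generator_nonmax: "v \<in> generator_expos \<Longrightarrow> nonmax v"
proof -
  have g: "nonmax expo_g"
  proof -
    obtain e where e: "\<delta>2 * int \<epsilon> < e * \<delta>1" "e * int c3 \<le> int \<epsilon> * int r23"
      using eps_fraction by blast
    have "0 \<le> \<delta>2 * int \<epsilon>" using delta_pos(2) by simp
    then have "0 < e * \<delta>1" using e(1) by linarith
    then have "0 \<le> e" using delta_pos(1) by (simp only: zero_less_mult_iff) linarith
    then have "0 \<le> e * int c1" by simp
    with e show ?thesis
      unfolding expo_g_def nonmax_iff_lattice
      by (intro exI[of _ e] exI[of _ "int \<epsilon>"] conjI) (simp_all add: mult.commute)
  qed
  have p: "nonmax (expo_p \<alpha> \<beta>)" if "(\<alpha>, \<beta>) \<in> A" for \<alpha> \<beta>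
  proof -
    note adm = A_admissible[OF that]
    have "int (\<beta> * r23) \<le> int (\<alpha> * c3)" using adm by simp
    then have "\<beta> * r23 \<le> \<alpha> * c3" by (simp only: of_nat_le_iff)
    then have "int (\<alpha> * c3 - \<beta> * r23) = int \<alpha> * int c3 - int \<beta> * int r23"
      by (simp add: of_nat_diff)
    with slope_above[OF adm] show ?thesis
      unfolding expo_p_def nonmax_iff_lattice
      by (intro exI[of _ "int \<alpha>"] exI[of _ "int \<beta>"] conjI) simp_all
  qed
  have q: "nonmax (expo_q \<gamma> \<sigma>)" if "(\<gamma>, \<sigma>) \<in> B" for \<gamma> \<sigma>
  proof -
    note adm = B_admissible[OF that]
    have "int (\<gamma> * c3) \<le> int (\<sigma> * r23)" using slope_below[OF adm] by simp
    then have "\<gamma> * c3 \<le> \<sigma> * r23" by (simp only: of_nat_le_iff)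
    then have "int (\<sigma> * r23 - \<gamma> * c3) = int \<sigma> * int r23 - int \<gamma> * int c3"
      by (simp add: of_nat_diff)
    moreover have "(- int \<sigma>) * \<delta>2 < (- int \<gamma>) * \<delta>1" using adm by simp
    ultimately show ?thesis
      unfolding expo_q_def nonmax_iff_lattice
      by (intro exI[of _ "- int \<gamma>"] exI[of _ "- int \<sigma>"] conjI) simp_all
  qed
  show "nonmax v" if "v \<in> generator_expos"
    using that g p q by (auto simp: generator_expos_def)
qed

text \<open>
  If \<open>\<beta> < \<epsilon>\<close>, the record at or before \<open>\<beta>\<close> has no larger exponent in \<open>y\<close> or \<open>z\<close>; otherwise \<open>g\<close>
  divides.
\<close>

lemma multiple_of_p:
  assumes adm: "0 < int \<alpha> * int c3 - int \<beta> * int r23"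
    and j: "\<beta> * c2 \<le> j" and k: "int \<alpha> * int c3 - int \<beta> * int r23 \<le> int k"
  shows "\<exists>v\<in>generator_expos. \<exists>t. (i, j, k) = t + v"
proof (cases "\<epsilon> \<le> \<beta>")
  case True
  then have "\<epsilon> * c2 \<le> j" using j by (meson le_trans mult_le_mono1)
  then show ?thesis
    using expo_split[of 0 i "\<epsilon> * c2" j 0 k] by (auto simp: generator_expos_def expo_g_def)
next
  case False
  obtain \<beta>' where \<beta>': "\<beta>' \<in> records (val_A c3 r23)" "\<beta>' \<le> \<beta>" "val_A c3 r23 \<beta>' \<le> val_A c3 r23 \<beta>"
    using record_below by blast
  define \<alpha>' where "\<alpha>' = alpha_min c3 r23 \<beta>'"
  have A: "(\<alpha>', \<beta>') \<in> A" using \<beta>' False by (auto simp: A_eq \<alpha>'_def)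
  have "\<beta>' * c2 \<le> j" using \<beta>'(2) j by (meson le_trans mult_le_mono1)
  moreover have "int (\<alpha>' * c3 - \<beta>' * r23) \<le> int k"
  proof -
    have "val_A c3 r23 \<beta>' \<le> int k" using \<beta>'(3) val_A_le[OF adm] k by linarith
    then have "int (\<alpha>' * c3) - int (\<beta>' * r23) \<le> int k" by (simp add: val_A_def \<alpha>'_def)
    then show ?thesis by linarith
  qed
  ultimately have "\<exists>t. (i, j, k) = t + expo_p \<alpha>' \<beta>'"
    unfolding expo_p_def by (intro expo_split) simp_all
  then show ?thesis using A by (force simp: generator_expos_def)
qed

text \<open>
  The record at or before \<open>\<gamma>\<close> has no larger exponent of \<open>z\<close>. Its \<open>\<sigma>'\<close> is at most \<open>\<sigma>\<close>, since it is
  the least number with \<open>\<sigma>' \<delta>2 > \<gamma>' \<delta>1\<close> and \<open>\<gamma>' \<le> \<gamma>\<close>, so the exponent of \<open>x\<close> is no larger either.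
\<close>

lemma multiple_of_q:
  assumes adm: "0 < - int \<gamma> * \<delta>1 + int \<sigma> * \<delta>2"
    and i: "\<gamma> * c1 + \<sigma> * r21 \<le> i" and k: "- int \<gamma> * int c3 + int \<sigma> * int r23 \<le> int k"
  shows "\<exists>v\<in>generator_expos. \<exists>t. (i, j, k) = t + v"
proof -
  obtain \<gamma>' where \<gamma>': "\<gamma>' \<in> records (val_B c3 r23 \<delta>1 \<delta>2)" "\<gamma>' \<le> \<gamma>"
    "val_B c3 r23 \<delta>1 \<delta>2 \<gamma>' \<le> val_B c3 r23 \<delta>1 \<delta>2 \<gamma>"
    using record_below by blast
  define \<sigma>' where "\<sigma>' = sigma_min \<delta>1 \<delta>2 \<gamma>'"
  have B: "(\<gamma>', \<sigma>') \<in> B" using \<gamma>' by (auto simp: B_eq \<sigma>'_def)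
  have "int \<gamma>' * \<delta>1 \<le> int \<gamma> * \<delta>1" using \<gamma>'(2) delta_pos(1) by (intro mult_right_mono) simp_all
  then have "0 < - int \<gamma>' * \<delta>1 + int \<sigma> * \<delta>2" using adm by simp
  then have "\<sigma>' \<le> \<sigma>" unfolding \<sigma>'_def by (simp only: sigma_min_iff)
  then have "\<gamma>' * c1 + \<sigma>' * r21 \<le> i" using \<gamma>'(2) i by (meson add_mono le_trans mult_le_mono1)
  moreover have "int (\<sigma>' * r23 - \<gamma>' * c3) \<le> int k"
  proof -
    have "val_B c3 r23 \<delta>1 \<delta>2 \<gamma>' \<le> int k" using \<gamma>'(3) val_B_le[OF adm] k by linarith
    then have "int (\<sigma>' * r23) - int (\<gamma>' * c3) \<le> int k" by (simp add: val_B_def \<sigma>'_def)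
    then show ?thesis by linarith
  qed
  ultimately have "\<exists>t. (i, j, k) = t + expo_q \<gamma>' \<sigma>'"
    unfolding expo_q_def by (intro expo_split) simp_all
  then show ?thesis using B by (force simp: generator_expos_def)
qed

text \<open>
  Let \<open>(s, t)\<close> be a relation that raises the degree. If \<open>t \<ge> 0\<close> then \<open>s > 0\<close>, and \<open>y\<close> loses the
  exponent \<open>t c2\<close>. In case \<open>s c3 > t r23\<close> also \<open>z\<close> loses, which gives some \<open>p\<close>; in case
  \<open>s c3 \<le> t r23\<close> the fraction \<open>s / t\<close> competes in the definition of \<open>\<epsilon>\<close>, which gives \<open>g\<close>. If
  \<open>t < 0 < s\<close>, the monomial is divisible by \<open>z\<^sup>c\<^sup>3\<close>, which is \<open>p\<close> for \<open>(1, 0)\<close>. If \<open>t < 0\<close> and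
  \<open>s \<le> 0\<close>, both \<open>x\<close> and \<open>z\<close> lose, which gives some \<open>q\<close>.
\<close>

lemma nonmax_multiple_of_generator:
  assumes "nonmax (i, j, k)"
  shows "\<exists>v\<in>generator_expos. \<exists>t. (i, j, k) = t + v"
proof -
  obtain s t where deg: "t * \<delta>2 < s * \<delta>1" and i: "0 \<le> int i + s * int c1 + t * int r21"
    and j: "0 \<le> int j - t * int c2" and k: "0 \<le> int k - s * int c3 + t * int r23"
    using assms unfolding nonmax_iff_lattice by blast
  show ?thesis
  proof (cases "0 \<le> t")
    case True
    then have "0 \<le> t * \<delta>2" using delta_pos(2) by simp
    then have "0 < s * \<delta>1" using deg by linarith
    then have "0 < s" using delta_pos(1) by (simp only: zero_less_mult_iff) linarith
    define \<alpha> \<beta> where "\<alpha> = nat s" and "\<beta> = nat t"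
    have st: "s = int \<alpha>" "t = int \<beta>" using True \<open>0 < s\<close> by (simp_all add: \<alpha>_def \<beta>_def)
    have "int (\<beta> * c2) \<le> int j" using j by (simp add: st)
    then have j': "\<beta> * c2 \<le> j" by (simp only: of_nat_le_iff)
    show ?thesis
    proof (cases "0 < int \<alpha> * int c3 - int \<beta> * int r23")
      case True
      then show ?thesis using j' k by (intro multiple_of_p[of \<alpha> \<beta>]) (simp_all add: st)
    next
      case False
      have "0 < int \<alpha> * int c3" using \<open>0 < s\<close> c_pos by (simp add: st)
      then have "0 < int \<beta> * int r23" using False by linarith
      then have "0 < \<beta>" by (simp add: zero_less_mult_iff)
      \<comment> \<open>Here \<open>\<alpha> / \<beta>\<close> lies in the interval that defines \<open>\<epsilon>\<close>.\<close>
      then have "\<epsilon> \<le> \<beta>"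
        using eps_least[of \<beta> "int \<alpha>"] deg False by (simp add: st mult.commute)
      then have "\<epsilon> * c2 \<le> j" using j' by (meson le_trans mult_le_mono1)
      then show ?thesis
        using expo_split[of 0 i "\<epsilon> * c2" j 0 k] by (auto simp: generator_expos_def expo_g_def)
    qed
  next
    case t: False
    define \<sigma> where "\<sigma> = nat (- t)"
    have t_eq: "t = - int \<sigma>" using t by (simp add: \<sigma>_def)
    show ?thesis
    proof (cases "0 < s")
      case True
      have "int c3 \<le> s * int c3" using True c_pos by simp
      moreover have "t * int r23 \<le> 0" using t by (simp add: mult_nonpos_nonneg)
      ultimately have "int c3 \<le> int k" using k by linarith
      then show ?thesis by (intro multiple_of_p[of 1 0]) (simp_all add: c_pos)
    next
      case False
      define \<gamma> where "\<gamma> = nat (- s)"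
      have s_eq: "s = - int \<gamma>" using False by (simp add: \<gamma>_def)
      have "int (\<gamma> * c1 + \<sigma> * r21) \<le> int i" using i by (simp add: t_eq s_eq)
      then have "\<gamma> * c1 + \<sigma> * r21 \<le> i" by (simp only: of_nat_le_iff)
      then show ?thesis
        using deg k by (intro multiple_of_q[of \<gamma> \<sigma>]) (simp_all add: t_eq s_eq)
    qed
  qed
qed

lemma nonmax_iff_multiple: "nonmax m \<longleftrightarrow> (\<exists>v\<in>generator_expos. \<exists>t. m = t + v)"
  using generator_nonmax nonmax_add nonmax_multiple_of_generator by (cases m) blast

section \<open>Generators of the initial form ideal\<close>

lemma h_similar: "similar (0, hy, 0) (hx, 0, hz)"
proof -
  have "int hx = int \<alpha>h * int c1 + int \<beta>h * int r21" "int hy = int \<beta>h * int c2"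
    by (simp_all add: hx_eq hy_eq)
  then have "int (hy * n2) = int (hx * n1 + hz * n3)"
    unfolding of_nat_add of_nat_mult using hz_eq int_relations by algebra
  then have "hy * n2 = hx * n1 + hz * n3" by (simp only: of_nat_eq_iff)
  then show ?thesis using h_degree by (simp add: similar_def)
qed

definition I_star :: "'k::field poly3 set" where
  "I_star = initial_form_ideal (toric_ideal n1 n2 n3)"

definition generator_monomials :: "'k::field poly3 set" where
  "generator_monomials = (\<lambda>v. Poly_Mapping.single v 1) ` generator_expos"

lemma span_I_star: "ideal.span I_star = (I_star :: 'k::field poly3 set)"
  unfolding I_star_def initial_form_ideal_def by (rule ideal.span_span)

lemma nonmax_in_I_star: "nonmax m \<Longrightarrow> Poly_Mapping.single m 1 \<in> (I_star :: 'k::field poly3 set)"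
  unfolding I_star_def initial_form_ideal_toric initial_generators_def by (intro ideal.span_base) blast

lemma h_in_I_star: "(h_poly :: 'k::field poly3) \<in> I_star"
  unfolding I_star_def initial_form_ideal_toric initial_generators_def h_poly_def mon_def
  using h_similar by (intro ideal.span_base) blast

lemma generators_in_I_star: "insert h_poly generator_monomials \<subseteq> (I_star :: 'k::field poly3 set)"
  unfolding generator_monomials_def using h_in_I_star nonmax_in_I_star generator_nonmax by blast

text \<open>
  It suffices to generate \<open>h\<close> and the nonmaximal monomials, since \<open>h\<close> generates the differences of
  similar monomials.
\<close>

lemma I_star_eqI:
  assumes "F \<subseteq> (I_star :: 'k::field poly3 set)" and h: "h_poly \<in> ideal.span F"
    and nonmax: "\<And>m. nonmax m \<Longrightarrow> Poly_Mapping.single m 1 \<in> ideal.span F"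
  shows "I_star = ideal.span F"
proof
  have "ideal.span {h_poly} \<subseteq> ideal.span F"
    using h by (intro ideal.span_minimal) simp_all
  then have "initial_generators \<subseteq> ideal.span F"
    using nonmax similar_diff_in_span unfolding initial_generators_def by blast
  then show "I_star \<subseteq> ideal.span F"
    unfolding I_star_def initial_form_ideal_toric by (intro ideal.span_minimal) simp_all
  show "ideal.span F \<subseteq> I_star"
    using ideal.span_mono[OF assms(1)] by (simp only: span_I_star)
qed

lemma nonmax_in_span:
  assumes "nonmax m" and "generator_monomials \<subseteq> ideal.span F"
  shows "Poly_Mapping.single m 1 \<in> ideal.span (F :: 'k::field poly3 set)"
proof -
  obtain v t where v: "v \<in> generator_expos" "m = t + v"
    using assms(1) nonmax_iff_multiple by blast
  have "Poly_Mapping.single v 1 \<in> ideal.span F"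
    using assms(2) v(1) by (auto simp: generator_monomials_def)
  then show ?thesis unfolding v(2) by (rule single_add_mem_span)
qed

theorem I_star_generators:
  "I_star = ideal.span (insert h_poly (generator_monomials :: 'k::field poly3 set))"
proof (rule I_star_eqI)
  show "Poly_Mapping.single m 1 \<in> ideal.span (insert h_poly (generator_monomials :: 'k poly3 set))"
    if "nonmax m" for m
    using that by (rule nonmax_in_span) (auto intro: ideal.span_base)
qed (use generators_in_I_star in \<open>auto intro: ideal.span_base\<close>)

text \<open>
  The first term of \<open>h\<close> is a multiple of \<open>g\<close>, hence nonmaximal, and the second term is similar to
  the first.
\<close>

theorem I_star_without_h:
  assumes "\<epsilon> < \<beta>h"
  shows "I_star = ideal.span (generator_monomials :: 'k::field poly3 set)"
proof (rule I_star_eqI)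
  show nm: "Poly_Mapping.single m 1 \<in> ideal.span (generator_monomials :: 'k poly3 set)"
    if "nonmax m" for m
    using that by (rule nonmax_in_span) (auto intro: ideal.span_base)
  have "\<epsilon> * c2 \<le> hy" using assms by (simp add: hy_eq)
  then have "nonmax (0, hy, 0)"
    using expo_split[of 0 0 "\<epsilon> * c2" hy 0 0]
    by (auto simp: nonmax_iff_multiple generator_expos_def expo_g_def)
  moreover from this have "nonmax (hx, 0, hz)" using nonmax_similar h_similar by blast
  ultimately show "h_poly \<in> ideal.span (generator_monomials :: 'k poly3 set)"
    unfolding h_poly_def mon_def by (intro ideal.span_diff nm)
qed (use generators_in_I_star in auto)

definition reduced_expos :: "expo set" where
  "reduced_expos = case_prod expo_p ` {v \<in> A. snd v < \<beta>h} \<union> case_prod expo_q ` B"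

text \<open>
  A nonmaximal monomial that is not divisible by a remaining generator has an exponent of \<open>y\<close> that
  is at least \<open>hy\<close>. Subtracting a multiple of \<open>h\<close> gives a similar, hence nonmaximal, monomial with
  a smaller exponent of \<open>y\<close>.
\<close>

theorem I_star_with_h:
  assumes "\<beta>h \<le> \<epsilon>"
  shows "I_star = ideal.span (insert h_poly ((\<lambda>v. Poly_Mapping.single v 1) ` reduced_expos :: 'k::field poly3 set))"
    (is "_ = ideal.span ?F")
proof (rule I_star_eqI)
  have sub: "reduced_expos \<subseteq> generator_expos"
    by (auto simp: reduced_expos_def generator_expos_def)
  then show "?F \<subseteq> I_star"
    using generators_in_I_star by (auto simp: generator_monomials_def)
  show h: "h_poly \<in> ideal.span ?F" by (intro ideal.span_base) simp
  have "Poly_Mapping.single (i, j, k) 1 \<in> ideal.span ?F" if "nonmax (i, j, k)" for i j k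
    using that
  proof (induction j arbitrary: i k rule: less_induct)
    case (less j)
    then obtain v t where v: "v \<in> generator_expos" "(i, j, k) = t + v"
      using nonmax_iff_multiple by blast
    show ?case
    proof (cases "v \<in> reduced_expos")
      case True
      then have "Poly_Mapping.single v 1 \<in> ideal.span ?F" by (intro ideal.span_base) simp
      then show ?thesis unfolding v(2) by (rule single_add_mem_span)
    next
      case False
      obtain t1 t2 t3 where t: "t = (t1, t2, t3)" by (cases t)
      have "\<beta>h * c2 \<le> j"
      proof -
        obtain \<beta> z where \<beta>: "v = (0, \<beta> * c2, z)" "\<beta>h \<le> \<beta>"
          using v(1) False assms
          by (force simp: generator_expos_def reduced_expos_def expo_g_def expo_p_def)
        have "\<beta>h * c2 \<le> \<beta> * c2" using \<beta>(2) by (rule mult_le_mono1)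
        moreover have "j = t2 + \<beta> * c2" using v(2) t \<beta>(1) by simp
        ultimately show ?thesis by linarith
      qed
      then have "hy \<le> j" by (simp only: hy_eq)
      then have j: "j = (j - hy) + 1 * hy" "j - hy < j" using h_pos(2) by simp_all
      let ?m = "(i + 1 * hx, j - hy, k + 1 * hz)"
      have "similar ((i, j - hy, k) + (0, hy, 0)) ((i, j - hy, k) + (hx, 0, hz))"
        using h_similar by (simp only: similar_add_left)
      then have "similar (i, j, k) ?m" using j(1) by simp
      then have "nonmax ?m" using nonmax_similar less.prems by blast
      then have "Poly_Mapping.single ?m 1 \<in> ideal.span ?F" by (rule less.IH[OF j(2)])
      moreover have "Poly_Mapping.single (i, j, k) 1 - Poly_Mapping.single ?m 1 \<in> ideal.span ?F"
        using multiple_of_h_in_span[of i "j - hy" 1 k] j(1) ideal.span_mono[of "{h_poly}" ?F] by auto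
      ultimately show ?thesis
        using ideal.span_add by fastforce
    qed
  qed
  then show "Poly_Mapping.single m 1 \<in> ideal.span ?F" if "nonmax m" for m
    using that by (cases m) blast
qed

section \<open>The number of generators\<close>

text \<open>
  The values at the records are distinct, positive and at most the first one, which is at most
  \<open>r23\<close>.
\<close>

lemma finite_records_B: "finite (records (val_B c3 r23 \<delta>1 \<delta>2))"
  and card_B_le: "card B \<le> r23"
proof -
  let ?f = "val_B c3 r23 \<delta>1 \<delta>2"
  have "?f 0 \<le> int r23" using val_B_le[of 0 1] delta_pos by simp
  then have "?f \<gamma> \<le> int r23" if "\<gamma> \<in> records ?f" for \<gamma>
    using that by (cases "\<gamma> = 0") (fastforce simp: records_def)+
  then have "?f \<gamma> \<in> {1..int r23}" if "\<gamma> \<in> records ?f" for \<gamma>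
    using that val_B_pos[of \<gamma>] by simp
  then have img: "?f ` records ?f \<subseteq> {1..int r23}" by blast
  then show fin: "finite (records ?f)"
    by (rule inj_on_finite[OF inj_on_records]) simp
  have "card B \<le> card (records ?f)" unfolding B_eq by (rule card_image_le[OF fin])
  also have "\<dots> \<le> card {1..int r23}" by (rule card_inj_on_le[OF inj_on_records img]) simp
  finally show "card B \<le> r23" by simp
qed

lemma finite_A: "finite A"
  by (simp add: A_eq)

text \<open>
  The value at \<open>1\<close> is at most \<open>c3 - r23\<close>, which bounds the values at all records other than \<open>0\<close>.
  Without this saving, the two sets together could only be bounded by \<open>c3 + r23\<close>.
\<close>

lemma card_A_le: "card A \<le> 1 + (c3 - r23)"
proof -
  let ?f = "val_A c3 r23"
  let ?R = "{\<beta> \<in> records ?f. \<beta> < \<epsilon>}"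
  have f1: "?f 1 \<le> int (c3 - r23)" using val_A_le[of 1 1] r23_less by simp
  have "?f \<beta> \<le> int (c3 - r23)" if "\<beta> \<in> ?R - {0}" for \<beta>
  proof (cases "\<beta> = 1")
    case False
    with that have "?f \<beta> < ?f 1" by (auto simp: records_def)
    with f1 show ?thesis by simp
  qed (use f1 in simp)
  then have "?f \<beta> \<in> {1..int (c3 - r23)}" if "\<beta> \<in> ?R - {0}" for \<beta>
    using that val_A_pos[of \<beta>] by simp
  then have "?f ` (?R - {0}) \<subseteq> {1..int (c3 - r23)}" by blast
  then have "card (?R - {0}) \<le> card {1..int (c3 - r23)}"
    by (intro card_inj_on_le[OF inj_on_subset[OF inj_on_records]]) auto
  moreover have "card ?R \<le> Suc (card (?R - {0}))"
    using card_Suc_Diff1[of ?R 0] card_Diff_singleton_if[of ?R 0] by (simp split: if_splits)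
  moreover have "card A \<le> card ?R" unfolding A_eq by (rule card_image_le) simp
  ultimately show ?thesis by simp
qed

lemma finite_B: "finite B"
  by (simp add: B_eq finite_records_B)

lemma finite_generator_expos: "finite generator_expos"
  by (simp add: generator_expos_def finite_A finite_B)

lemma mu_le:
  assumes "finite G" and "ideal.span G = J"
  shows "mu J \<le> card G"
  unfolding mu_def using assms by (intro Least_le) blast

theorem mu_I_star_le: "mu (I_star :: 'k::field poly3 set) \<le> c3 + 2"
proof -
  have bound: "card A + card B \<le> c3 + 1" using card_A_le card_B_le r23_less by linarith
  show ?thesis
  proof (cases "\<epsilon> < \<beta>h")
    case True
    have "card (generator_monomials :: 'k poly3 set) \<le> card generator_expos"
      unfolding generator_monomials_def by (rule card_image_le[OF finite_generator_expos])
    also have "\<dots> \<le> Suc (card (case_prod expo_p ` A \<union> case_prod expo_q ` B))"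
      unfolding generator_expos_def by (rule card_insert_le_m1) simp_all
    also have "\<dots> \<le> Suc (card (case_prod expo_p ` A) + card (case_prod expo_q ` B))"
      using card_Un_le by simp
    also have "\<dots> \<le> Suc (card A + card B)"
      by (intro Suc_leI le_imp_less_Suc add_mono card_image_le finite_A finite_B)
    finally have "card (generator_monomials :: 'k poly3 set) \<le> c3 + 2" using bound by simp
    moreover have "mu (I_star :: 'k poly3 set) \<le> card (generator_monomials :: 'k poly3 set)"
      using finite_generator_expos
      by (intro mu_le I_star_without_h[OF True, symmetric]) (simp add: generator_monomials_def)
    ultimately show ?thesis by simp
  next
    case False
    let ?M = "(\<lambda>v. Poly_Mapping.single v 1) ` reduced_expos :: 'k poly3 set"
    have fin: "finite reduced_expos" by (simp add: reduced_expos_def finite_A finite_B)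
    have "card ?M \<le> card reduced_expos" by (rule card_image_le[OF fin])
    also have "\<dots> \<le> card (case_prod expo_p ` {v \<in> A. snd v < \<beta>h}) + card (case_prod expo_q ` B)"
      unfolding reduced_expos_def by (rule card_Un_le)
    also have "\<dots> \<le> card {v \<in> A. snd v < \<beta>h} + card B"
      by (intro add_mono card_image_le) (simp_all add: finite_A finite_B)
    also have "\<dots> \<le> card A + card B" using card_mono[OF finite_A, of "{v \<in> A. snd v < \<beta>h}"] by auto
    finally have "card ?M \<le> c3 + 1" using bound by simp
    then have "card (insert h_poly ?M) \<le> c3 + 2"
      using card_insert_if[of ?M h_poly] fin by (simp split: if_splits)
    moreover have "mu (I_star :: 'k poly3 set) \<le> card (insert h_poly ?M)"
      using fin False by (intro mu_le I_star_with_h[symmetric]) simp_all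
    ultimately show ?thesis by simp
  qed
qed

section \<open>Groebner bases of the initial form ideal\<close>

lemma keys_h: "Poly_Mapping.keys (h_poly :: 'k::field poly3) = {(0, hy, 0), (hx, 0, hz)}"
  using h_pos
  by (auto simp: h_poly_def mon_def in_keys_iff lookup_minus lookup_single when_def split: if_splits)

lemma leading_expo_h: "leading_expo (h_poly :: 'k::field poly3) = (0, hy, 0)"
  by (rule leading_expo_eqI) (use h_pos h_degree in \<open>auto simp: keys_h\<close>)

text \<open>
  Only the generators \<open>q\<close> contain \<open>x\<close>. If \<open>\<gamma> < \<alpha>h\<close>, then \<open>\<sigma> \<le> \<beta>h\<close> by the minimality of \<open>\<sigma>\<close>, and
  the exponent of \<open>x\<close> is too small. If \<open>\<gamma> \<ge> \<alpha>h\<close>, then \<open>(\<gamma> - \<alpha>h, \<sigma> - \<beta>h)\<close> is admissible as well,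
  because \<open>\<alpha>h \<delta>1 = \<beta>h \<delta>2\<close>, and its value is smaller by \<open>hz\<close>. So \<open>\<gamma>\<close> is no record.
\<close>

lemma trailing_term_of_h:
  assumes "v \<in> generator_expos"
  shows "v \<noteq> t + (hx, 0, hz)"
proof
  assume v: "v = t + (hx, 0, hz)"
  obtain t1 t2 t3 where t: "t = (t1, t2, t3)" by (cases t)
  obtain \<gamma> \<sigma> where B: "(\<gamma>, \<sigma>) \<in> B" and "v = expo_q \<gamma> \<sigma>"
    using assms v h_pos(1) t by (auto simp: generator_expos_def expo_g_def expo_p_def)
  then have x: "hx \<le> \<gamma> * c1 + \<sigma> * r21" and z: "hz \<le> \<sigma> * r23 - \<gamma> * c3"
    using v t by (auto simp: expo_q_def)
  from B have \<gamma>: "\<gamma> \<in> records (val_B c3 r23 \<delta>1 \<delta>2)" and \<sigma>: "\<sigma> = sigma_min \<delta>1 \<delta>2 \<gamma>"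
    by (auto simp: B_eq)
  note adm = B_admissible[OF B]
  show False
  proof (cases "\<gamma> < \<alpha>h")
    case True
    have "int \<gamma> * \<delta>1 < int \<alpha>h * \<delta>1"
      using True delta_pos(1) by (intro mult_strict_right_mono) simp_all
    then have "0 < - int \<gamma> * \<delta>1 + int \<beta>h * \<delta>2" using slope_h by linarith
    then have "\<sigma> \<le> \<beta>h" unfolding \<sigma> by (simp only: sigma_min_iff)
    then have "\<sigma> * r21 \<le> \<beta>h * r21" by simp
    moreover have "\<gamma> * c1 < \<alpha>h * c1" using True c_pos by simp
    ultimately show False using x unfolding hx_eq by linarith
  next
    case False
    have "int \<alpha>h * \<delta>1 \<le> int \<gamma> * \<delta>1"
      using False delta_pos(1) by (intro mult_right_mono) simp_all
    then have "int \<beta>h * \<delta>2 < int \<sigma> * \<delta>2" using adm slope_h by linarith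
    then have "\<beta>h < \<sigma>" using delta_pos(2) by (simp only: mult_less_cancel_right_pos of_nat_less_iff)
    have int: "int (\<gamma> - \<alpha>h) = int \<gamma> - int \<alpha>h" "int (\<sigma> - \<beta>h) = int \<sigma> - int \<beta>h"
      using False \<open>\<beta>h < \<sigma>\<close> by simp_all
    have "- int (\<gamma> - \<alpha>h) * \<delta>1 + int (\<sigma> - \<beta>h) * \<delta>2 = - int \<gamma> * \<delta>1 + int \<sigma> * \<delta>2"
      unfolding int using slope_h by algebra
    then have "val_B c3 r23 \<delta>1 \<delta>2 (\<gamma> - \<alpha>h)
        \<le> - int (\<gamma> - \<alpha>h) * int c3 + int (\<sigma> - \<beta>h) * int r23"
      using adm by (intro val_B_le) simp
    also have "\<dots> = val_B c3 r23 \<delta>1 \<delta>2 \<gamma> - int hz"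
      unfolding int val_B_def \<sigma>[symmetric] hz_eq by algebra
    also have "\<dots> < val_B c3 r23 \<delta>1 \<delta>2 \<gamma>" using h_pos(3) by simp
    finally have "val_B c3 r23 \<delta>1 \<delta>2 (\<gamma> - \<alpha>h) < val_B c3 r23 \<delta>1 \<delta>2 \<gamma>" .
    moreover have "\<gamma> - \<alpha>h < \<gamma>" using False \<alpha>h_pos by simp
    ultimately show False using \<gamma> by (auto simp: records_def)
  qed
qed

text \<open>
  If the leading exponent is not nonmaximal, then \<open>f\<close> has another term similar to it. That term is
  smaller in the order, so its exponent of \<open>z\<close> is larger, and it arises from the leading exponent
  by replacing the leading term of \<open>h\<close> by the trailing one a positive number of times.
\<close>

lemma leading_expo_in_I_star:
  assumes "f \<in> (I_star :: 'k::field poly3 set)" and "f \<noteq> 0"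
  shows "\<exists>v\<in>insert (0, hy, 0) generator_expos. \<exists>t. leading_expo f = t + v"
proof (cases "nonmax (leading_expo f)")
  case True
  then show ?thesis using nonmax_iff_multiple by blast
next
  case False
  obtain i j k where m: "leading_expo f = (i, j, k)" by (cases "leading_expo f")
  note max = leading_expo_maximal[OF assms(2)]
  obtain m' where m': "m' \<in> Poly_Mapping.keys f" "m' \<noteq> leading_expo f" "similar (leading_expo f) m'"
    using max_term_has_similar_term[OF _ max(1) False] assms(1) by (auto simp: I_star_def)
  obtain i' j' k' where eq: "m' = (i', j', k')" by (cases m')
  have "revlex_less m' (leading_expo f)" using max(2) m' by blast
  then have "k \<le> k'" using m'(3) by (auto simp: m eq similar_def)
  then obtain t where t: "i' = i + t * hx" "j = j' + t * hy" "k' = k + t * hz"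
    using similar_differ_by_multiple_of_h[of i j k i' j' k'] m'(3) unfolding m eq by blast
  have "t \<noteq> 0" using m'(2) t by (auto simp: m eq)
  then have "hy \<le> t * hy" by simp
  then have "hy \<le> j" using t(2) by linarith
  then have "\<exists>t. leading_expo f = t + (0, hy, 0)" unfolding m by (intro expo_split) simp_all
  then show ?thesis by blast
qed

text \<open>
  Each leading monomial \<open>v\<close> of the full set of generators occurs in an element of the ideal
  spanned by \<open>G\<close>, so it is a multiple of a term of some \<open>u \<in> G\<close>. This term is the leading one: the
  only other possibility is the trailing term of \<open>h\<close>, which does not divide \<open>v\<close>.
\<close>

theorem generating_subset_is_groebner_basis:
  fixes G :: "'k::field poly3 set"
  assumes sub: "G \<subseteq> insert h_poly generator_monomials" and span: "ideal.span G = I_star"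
  shows "groebner_basis G I_star"
proof -
  have fin: "finite G"
    using finite_subset[OF sub] finite_generator_expos by (simp add: generator_monomials_def)
  have G: "G \<subseteq> I_star" using ideal.span_superset[of G] span by simp
  have lead: "\<exists>u\<in>G. u \<noteq> 0 \<and> (\<exists>t. v = t + leading_expo u)"
    if v: "v \<in> insert (0, hy, 0) generator_expos" for v
  proof -
    have "\<exists>f\<in>ideal.span G. v \<in> Poly_Mapping.keys f"
    proof (cases "v = (0, hy, 0)")
      case True
      then show ?thesis using h_in_I_star span keys_h by (metis insertI1)
    next
      case False
      then have "Poly_Mapping.single v 1 \<in> ideal.span G"
        using v nonmax_in_I_star generator_nonmax span by blast
      then show ?thesis by (intro bexI[of _ "Poly_Mapping.single v 1"]) simp_all
    qed
    then obtain u w t where u: "u \<in> G" "w \<in> Poly_Mapping.keys u" "v = t + w"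
      using keys_of_span by blast
    have "w = leading_expo u"
    proof (cases "u = h_poly")
      case True
      have "v \<noteq> t + (hx, 0, hz)"
      proof (cases "v = (0, hy, 0)")
        case True
        then show ?thesis using h_pos by (cases t) auto
      next
        case False
        then show ?thesis using v trailing_term_of_h by blast
      qed
      then show ?thesis using True u by (auto simp: keys_h leading_expo_h)
    next
      case False
      then obtain v' where "u = Poly_Mapping.single v' 1"
        using u(1) sub by (auto simp: generator_monomials_def)
      then show ?thesis using u(2) by simp
    qed
    moreover have "u \<noteq> 0" using u(2) by auto
    ultimately show ?thesis using u by blast
  qed
  have "Poly_Mapping.single (leading_expo f) 1 \<in> leading_ideal G"
    if f: "f \<in> I_star" "f \<noteq> 0" for f :: "'k poly3"
  proof -
    obtain v t where v: "v \<in> insert (0, hy, 0) generator_expos" "leading_expo f = t + v"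
      using leading_expo_in_I_star[OF f] by blast
    obtain u s where u: "u \<in> G" "u \<noteq> 0" "v = s + leading_expo u" using lead[OF v(1)] by blast
    have eq: "leading_expo f = (t + s) + leading_expo u" using v(2) u(3) by (simp only: add.assoc)
    have "Poly_Mapping.single (leading_expo u) 1 \<in> leading_ideal G"
      unfolding leading_ideal_def using u by (intro ideal.span_base) blast
    then show ?thesis unfolding leading_ideal_def eq by (rule single_add_mem_span)
  qed
  then have "leading_ideal I_star \<subseteq> leading_ideal G"
    unfolding leading_ideal_def[of I_star]
    by (intro ideal.span_minimal) (auto simp: leading_ideal_def)
  moreover have "leading_ideal G \<subseteq> leading_ideal I_star"
    unfolding leading_ideal_def using G by (intro ideal.span_mono) blast
  ultimately show ?thesis using fin G by (simp add: groebner_basis_def)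
qed

end

theorem lemma3p16:
  fixes n1 n2 n3 a b d c1 c2 c3 r12 r13 r21 r23 r31 r32 \<alpha>h \<beta>h \<epsilon> :: nat
    and \<delta>1 \<delta>2 :: int
    and A B :: "(nat \<times> nat) set"
    and I Istar P Q :: "'k::field poly3 set"
    and g h :: "'k poly3"
  assumes "0 < n1" and "n1 < n2" and "n2 < n3"
    and "gcd n1 (gcd n2 n3) = 1"
    and "minimally_generates {n1, n2, n3} (semigroup_gen {n1, n2, n3})"
    and "I = toric_ideal n1 n2 n3"
    and "Istar = initial_form_ideal I"
    and "a = n2 - n1" and "b = n3 - n1" and "d = gcd a b"
    and "c1 = least_multiple n1 {n2, n3}"
    and "c2 = least_multiple n2 {n1, n3}"
    and "c3 = least_multiple n3 {n1, n2}"
    and "c1 * n1 = r12 * n2 + r13 * n3"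
    and "c2 * n2 = r21 * n1 + r23 * n3"
    and "c3 * n3 = r31 * n1 + r32 * n2"
    and "r12 = 0" and "r32 = 0"
    and "0 < r23" and "r23 < c3"
    and "c2 > r21 + r23"
    and "\<delta>1 = int c1 - int c3"
    and "\<delta>2 = int c2 - int r21 - int r23"
    and "0 < \<alpha>h" and "0 < \<beta>h"
    and "\<alpha>h * c1 + \<beta>h * r21 = (b - a) div d"
    and "\<beta>h * c2 = b div d"
    and "- int \<alpha>h * int c3 + int \<beta>h * int r23 = int (a div d)"
    and "\<epsilon> = eps c3 r23 \<delta>1 \<delta>2"
    and "A = setA c3 r23 \<epsilon>"
    and "B = setB c3 r23 \<delta>1 \<delta>2"
    and "g = mon 0 (\<epsilon> * c2) 0"
    and "h = mon 0 (b div d) 0 - mon ((b - a) div d) 0 (a div d)"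
    and "P = {p_mon c2 c3 r23 \<alpha> \<beta> | \<alpha> \<beta>. (\<alpha>, \<beta>) \<in> A}"
    and "Q = {q_mon c1 c3 r21 r23 \<gamma> \<sigma> | \<gamma> \<sigma>. (\<gamma>, \<sigma>) \<in> B}"
  shows "Istar = ideal.span ({g, h} \<union> P \<union> Q)
    \<and> (\<beta>h > \<epsilon> \<longrightarrow> Istar = ideal.span ({g} \<union> P \<union> Q))
    \<and> (\<beta>h \<le> \<epsilon> \<longrightarrow>
        Istar = ideal.span ({h} \<union> {p_mon c2 c3 r23 \<alpha> \<beta> | \<alpha> \<beta>. (\<alpha>, \<beta>) \<in> A \<and> \<beta> < \<beta>h} \<union> Q))
    \<and> (\<forall>G. G \<subseteq> {g, h} \<union> P \<union> Q \<and> minimal_generating_set G Istar \<longrightarrow> groebner_basis G Istar)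
    \<and> mu Istar \<le> c3 + 2"
proof -
  have ba: "b - a = n3 - n2" using assms(2,3,8,9) by simp
  have hx: "(b - a) div d = (n3 - n2) div gcd (n2 - n1) (n3 - n1)"
    unfolding ba unfolding assms(10) assms(8) assms(9) ..
  have hy: "b div d = (n3 - n1) div gcd (n2 - n1) (n3 - n1)"
    and hz: "a div d = (n2 - n1) div gcd (n2 - n1) (n3 - n1)"
    unfolding assms(10) assms(8) assms(9) by (rule refl)+
  have rel1: "c1 * n1 = r13 * n3" using assms(14) unfolding assms(17) by simp
  have rel3: "c3 * n3 = r31 * n1" using assms(16) unfolding assms(18) by simp
  interpret T: three_generators n1 n2 n3 c1 c2 c3 r13 r21 r23 r31 \<alpha>h \<beta>h
    "(b - a) div d" "b div d" "a div d"
    by unfold_locales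
      (fact assms rel1 rel3 hx hy hz assms(26)[symmetric] assms(27)[symmetric] assms(28)[symmetric])+
  have Istar: "Istar = T.I_star" unfolding T.I_star_def assms(7) assms(6) ..
  have h: "h = T.h_poly" unfolding T.h_poly_def assms(33) ..
  have \<epsilon>: "\<epsilon> = T.\<epsilon>" unfolding T.\<epsilon>_def assms(29) assms(22) assms(23) ..
  have A: "A = T.A" unfolding T.A_def assms(30) \<epsilon> ..
  have B: "B = T.B" unfolding T.B_def assms(31) assms(22) assms(23) ..
  have g: "g = Poly_Mapping.single T.expo_g 1"
    unfolding assms(32) T.expo_g_def mon_def \<epsilon> ..
  have Ps: "{p_mon c2 c3 r23 \<alpha> \<beta> | \<alpha> \<beta>. (\<alpha>, \<beta>) \<in> A \<and> R \<beta>}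
      = (\<lambda>v. Poly_Mapping.single v 1) ` (case_prod T.expo_p ` {v \<in> T.A. R (snd v)})" for R
    by (force simp: p_mon_def mon_def T.expo_p_def A image_iff)
  have P: "P = (\<lambda>v. Poly_Mapping.single v 1) ` (case_prod T.expo_p ` T.A)"
    using Ps[of "\<lambda>_. True"] unfolding assms(34) by simp
  have Q: "Q = (\<lambda>v. Poly_Mapping.single v 1) ` (case_prod T.expo_q ` T.B)"
    unfolding assms(35) by (force simp: q_mon_def mon_def T.expo_q_def B image_iff)
  have gens: "{g} \<union> P \<union> Q = T.generator_monomials"
    unfolding T.generator_monomials_def T.generator_expos_def g P Q by (simp add: image_Un)
  then have all: "{g, h} \<union> P \<union> Q = insert T.h_poly T.generator_monomials"
    unfolding h by blast
  have reduced: "{h} \<union> {p_mon c2 c3 r23 \<alpha> \<beta> | \<alpha> \<beta>. (\<alpha>, \<beta>) \<in> A \<and> \<beta> < \<beta>h} \<union> Q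
      = insert T.h_poly ((\<lambda>v. Poly_Mapping.single v 1) ` T.reduced_expos)"
    unfolding h Q Ps T.reduced_expos_def by (simp add: image_Un)
  show ?thesis
    unfolding all gens reduced Istar \<epsilon>
  proof (intro conjI allI impI)
    fix G :: "'k poly3 set"
    assume "G \<subseteq> insert T.h_poly T.generator_monomials \<and> minimal_generating_set G T.I_star"
    then show "groebner_basis G T.I_star"
      by (intro T.generating_subset_is_groebner_basis) (simp_all add: minimal_generating_set_def)
  qed (rule T.I_star_generators T.I_star_without_h T.I_star_with_h T.mu_I_star_le, assumption?)+
qed

end
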